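(* The quantitative emptiness and universality problems for PosSup and for AsSup are decidable: there is an algorithm that, given a probabilistic weighted $\mathsf{Sup}$-automaton $A$ over $\Sigma$ (with rational data) and a rational $\nu$, decides whether there exists $w\in\Sigma^\omega$ with $L_A(w)\ge\nu$ (emptiness), and an algorithm that decides whether $L_A(w)\ge\nu$ for all $w\in\Sigma^\omega$ (universality), where $L_A$ is $L^{>0}_A$ for PosSup and $L^{=1}_A$ for AsSup.
   Context: A probabilistic weighted automaton over a finite alphabet $\Sigma$ is a tuple $A=(Q,\rho_I,\Sigma,\delta,\gamma)$ where $Q$ is a finite set of states, $\rho_I$ is a probability distribution on $Q$, $\delta:Q\times\Sigma\to\mathcal D(Q)$ assigns to each state and letter a probability distribution on $Q$, and $\gamma:Q\times\Sigma\times Q\to\mathbb Q$ is a weight function. A run over an infinite word $w=\sigma_1\sigma_2\dots$ is a sequence $r=q_0\sigma_1q_1\sigma_2\dots$ with $\rho_I(q_0)>0$ and $\delta(q_i,\sigma_{i+1})(q_{i+1})>0$ for all $i$; its weight sequence is $\gamma(r)=v_0v_1\dots$ with $v_i=\gamma(q_i,\sigma_{i+1},q_{i+1})$. For each $w$, the probabilities of finite run prefixes $\rho_I(q_0)\prod_{i=1}^k\delta(q_{i-1},\sigma_i)(q_i)$ induce a probability measure $\mathbb P^A$ on runs over $w$. With $\mathsf{Sup}(v)=\sup_n v_n$, the positive semantics is $L^{>0}_A(w)=\sup\{\eta\mid \mathbb P^A(\{r:\mathsf{Sup}(\gamma(r))\ge\eta\})>0\}$ and the almost-sure semantics is $L^{=1}_A(w)=\sup\{\eta\mid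 \mathbb P^A(\{r:\mathsf{Sup}(\gamma(r))\ge\eta\})=1\}$. PosSup and AsSup denote the classes of $\mathsf{Sup}$-automata under positive and almost-sure semantics. *)

theory Defs
  imports "HOL-Probability.Probability" "HOL-Library.Nat_Bijection"
begin

datatype recf =
    Z
  | S
  | Id nat
  | Cn recf "recf list"
  | Pr recf recf
  | Mn recf

inductive eval_rf :: "recf \<Rightarrow> nat list \<Rightarrow> nat \<Rightarrow> bool" where
  ev_Z: "eval_rf Z xs 0"
| ev_S: "eval_rf S (x # xs) (Suc x)"
| ev_Id: "i < length xs \<Longrightarrow> eval_rf (Id i) xs (xs ! i)"
| ev_Cn: "length ys = length gs \<Longrightarrow> (\<forall>i < length gs. eval_rf (gs ! i) xs (ys ! i))
           \<Longrightarrow> eval_rf f ys y \<Longrightarrow> eval_rf (Cn f gs) xs y"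
| ev_Pr0: "eval_rf f xs y \<Longrightarrow> eval_rf (Pr f g) (0 # xs) y"
| ev_PrS: "eval_rf (Pr f g) (n # xs) z \<Longrightarrow> eval_rf g (n # z # xs) y
           \<Longrightarrow> eval_rf (Pr f g) (Suc n # xs) y"
| ev_Mn: "eval_rf g (y # xs) 0 \<Longrightarrow> (\<forall>z < y. \<exists>v. eval_rf g (z # xs) v \<and> v \<noteq> 0)
           \<Longrightarrow> eval_rf (Mn g) xs y"

text \<open>States are 0..<nq, letters are 0..<ns.
  init ! q = rho_I(q);  trans ! q ! a ! q' = delta(q,a)(q');  wt ! q ! a ! q' = gamma(q,a,q').\<close>

record pwa =
  nq :: nat
  ns :: nat
  init :: "rat list"
  trans :: "rat list list list"
  wt :: "rat list list list"

definition valid_pwa :: "pwa \<Rightarrow> bool" where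
  "valid_pwa A \<longleftrightarrow>
     0 < nq A \<and> 0 < ns A \<and>
     length (init A) = nq A \<and> (\<forall>q < nq A. 0 \<le> init A ! q) \<and>
     (\<Sum>q<nq A. init A ! q) = 1 \<and>
     length (trans A) = nq A \<and> length (wt A) = nq A \<and>
     (\<forall>q < nq A. length (trans A ! q) = ns A \<and> length (wt A ! q) = ns A \<and>
        (\<forall>a < ns A. length (trans A ! q ! a) = nq A \<and> length (wt A ! q ! a) = nq A \<and>
           (\<forall>q' < nq A. 0 \<le> trans A ! q ! a ! q') \<and>
           (\<Sum>q'<nq A. trans A ! q ! a ! q') = 1))"

definition init_p :: "pwa \<Rightarrow> nat \<Rightarrow> real" where
  "init_p A q = (if q < nq A then real_of_rat (init A ! q) else 0)"

definition trans_p :: "pwa \<Rightarrow> nat \<Rightarrow> nat \<Rightarrow> nat \<Rightarrow> real" where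
  "trans_p A q a q' =
     (if q < nq A \<and> a < ns A \<and> q' < nq A then real_of_rat (trans A ! q ! a ! q') else 0)"

definition wt_v :: "pwa \<Rightarrow> nat \<Rightarrow> nat \<Rightarrow> nat \<Rightarrow> real" where
  "wt_v A q a q' =
     (if q < nq A \<and> a < ns A \<and> q' < nq A then real_of_rat (wt A ! q ! a ! q') else 0)"

definition prefix_prob :: "pwa \<Rightarrow> nat stream \<Rightarrow> nat list \<Rightarrow> real" where
  "prefix_prob A w qs =
     init_p A (qs ! 0) * (\<Prod>i\<in>{1..<length qs}. trans_p A (qs ! (i - 1)) (w !! (i - 1)) (qs ! i))"

definition run_measure :: "pwa \<Rightarrow> nat stream \<Rightarrow> nat stream measure" where
  "run_measure A w = (THE M. prob_space M \<and> sets M = sets (stream_space (count_space UNIV)) \<and>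
      (\<forall>qs. qs \<noteq> [] \<longrightarrow>
         emeasure M {r \<in> space M. stake (length qs) r = qs} = ennreal (prefix_prob A w qs)))"

definition sup_weight :: "pwa \<Rightarrow> nat stream \<Rightarrow> nat stream \<Rightarrow> real" where
  "sup_weight A w r = (SUP i. wt_v A (r !! i) (w !! i) (r !! Suc i))"

definition L_pos :: "pwa \<Rightarrow> nat stream \<Rightarrow> real" where
  "L_pos A w = Sup {\<eta>. measure (run_measure A w)
       {r \<in> space (run_measure A w). sup_weight A w r \<ge> \<eta>} > 0}"

definition L_as :: "pwa \<Rightarrow> nat stream \<Rightarrow> real" where
  "L_as A w = Sup {\<eta>. measure (run_measure A w)
       {r \<in> space (run_measure A w). sup_weight A w r \<ge> \<eta>} = 1}"

definition words :: "pwa \<Rightarrow> nat stream set" where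
  "words A = {w. sset w \<subseteq> {0..<ns A}}"

definition enc_rat :: "rat \<Rightarrow> nat" where
  "enc_rat x = prod_encode (int_encode (fst (quotient_of x)), int_encode (snd (quotient_of x)))"

definition enc_list :: "('a \<Rightarrow> nat) \<Rightarrow> 'a list \<Rightarrow> nat" where
  "enc_list e xs = list_encode (map e xs)"

definition enc_input :: "pwa \<times> rat \<Rightarrow> nat" where
  "enc_input p = (case p of (A, \<nu>) \<Rightarrow>
     list_encode [nq A, ns A, enc_list enc_rat (init A),
       enc_list (enc_list (enc_list enc_rat)) (trans A),
       enc_list (enc_list (enc_list enc_rat)) (wt A), enc_rat \<nu>])"

definition decidable_pwa :: "(pwa \<Rightarrow> rat \<Rightarrow> bool) \<Rightarrow> bool" where
  "decidable_pwa P \<longleftrightarrow> (\<exists>f. \<forall>A \<nu>. valid_pwa A \<longrightarrow>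
       eval_rf f [enc_input (A, \<nu>)] (if P A \<nu> then 1 else 0))"

definition emptiness :: "(pwa \<Rightarrow> nat stream \<Rightarrow> real) \<Rightarrow> pwa \<Rightarrow> rat \<Rightarrow> bool" where
  "emptiness L A \<nu> \<longleftrightarrow> (\<exists>w \<in> words A. L A w \<ge> real_of_rat \<nu>)"

definition universality :: "(pwa \<Rightarrow> nat stream \<Rightarrow> real) \<Rightarrow> pwa \<Rightarrow> rat \<Rightarrow> bool" where
  "universality L A \<nu> \<longleftrightarrow> (\<forall>w \<in> words A. L A w \<ge> real_of_rat \<nu>)"

end

(*
  Fix the threshold nu and call an edge of weight at least nu a target edge. All weights of a run
  lie in a finite set, so L(w) >= nu says that the target edges are hit with positive probability,
  respectively with probability one.

  Each finite word acts on the states by a profile: which states can be reached without a hit, and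
  from which states a hit is possible. There are at most K = 2^(n(n+1)) profiles, so words can be
  shortened to length K, and a word of length K without a hit contains a loop and can be pumped to
  an infinite word without a hit. If from every surviving state a hit is possible within the next
  L letters, the probability of avoiding the target decays geometrically along blocks of length L.
  Hence
  - a word hits with positive probability iff some prefix admits a hitting path;
  - a word hitting almost surely exists iff there is a lasso u v^omega such that the survivors
    of u hit along v and their survivors under v stay among the survivors of u;
  - all words hit almost surely iff no survivor q of a word admits a word of length K that
    avoids the target from q.
  With the bound K these are bounded quantifications over words and paths, coded as numbers in
  base k and n, and hence recursive predicates of the code of the input.
*)
theory Submission
  imports Defs
begin

section \<open>Recursive functions\<close>

text \<open>The claim is about concrete terms of type \<open>recf\<close>, so every procedure has to
  be assembled from their constructors, including the decoding of nested lists of rationals. This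
  shapes the combinatorial part: the criteria are quantifications over short words with explicit
  bounds, not fixed points or graph searches, because recursive predicates are closed under bounded
  quantification and running time is irrelevant. Only the supports of the distributions and the
  comparison of weights with the threshold enter the criteria. The bound K counts the sets of pairs
  with n rows and n + 1 columns: one column for each surviving state and one for a hit. Two analytic
  gaps have to be closed: \<open>run_measure\<close> is a definite description, so existence and
  uniqueness of the measure must be proved, and L(w) is a supremum of thresholds, so L(w) >= nu must
  be reduced to the event at nu itself.\<close>

definition recn :: "nat \<Rightarrow> (nat list \<Rightarrow> nat) \<Rightarrow> bool" where
  "recn k f \<longleftrightarrow> (\<exists>r. \<forall>xs. length xs = k \<longrightarrow> eval_rf r xs (f xs))"

definition recursive :: "(nat \<Rightarrow> nat) \<Rightarrow> bool" where
  "recursive f \<longleftrightarrow> (\<exists>r. \<forall>x. eval_rf r [x] (f x))"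

section \<open>Closure of recursive functions under composition and primitive recursion\<close>

lemma recn_cong:
  assumes "recn k f" "\<And>xs. length xs = k \<Longrightarrow> f xs = g xs"
  shows "recn k g"
  using assms by (auto simp: recn_def)

lemma recn_nth: "i < k \<Longrightarrow> recn k (\<lambda>xs. xs ! i)"
  unfolding recn_def by (rule exI[of _ "Id i"]) (auto intro: ev_Id)

lemma recn_comp:
  assumes f: "recn (length gs) f" and gs: "\<And>g. g \<in> set gs \<Longrightarrow> recn k g"
  shows "recn k (\<lambda>xs. f (map (\<lambda>g. g xs) gs))"
proof -
  from f obtain rf where rf: "\<And>xs. length xs = length gs \<Longrightarrow> eval_rf rf xs (f xs)"
    by (auto simp: recn_def)
  from gs have "\<forall>g. \<exists>r. g \<in> set gs \<longrightarrow> (\<forall>xs. length xs = k \<longrightarrow> eval_rf r xs (g xs))"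
    by (auto simp: recn_def)
  then obtain R where R: "\<And>g xs. g \<in> set gs \<Longrightarrow> length xs = k \<Longrightarrow> eval_rf (R g) xs (g xs)"
    by metis
  have "eval_rf (Cn rf (map R gs)) xs (f (map (\<lambda>g. g xs) gs))" if "length xs = k" for xs
    by (rule ev_Cn[where ys = "map (\<lambda>g. g xs) gs"]) (auto intro: R rf that)
  then show ?thesis unfolding recn_def by blast
qed

lemma recn_comp1: "recn 1 f \<Longrightarrow> recn k g \<Longrightarrow> recn k (\<lambda>xs. f [g xs])"
  using recn_comp[of "[g]" f k] by auto

lemma recn_comp2: "recn 2 f \<Longrightarrow> recn k g \<Longrightarrow> recn k h \<Longrightarrow> recn k (\<lambda>xs. f [g xs, h xs])"
  using recn_comp[of "[g, h]" f k] by (auto simp: numeral_2_eq_2)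

lemma recn_Suc:
  assumes "recn k f"
  shows "recn k (\<lambda>xs. Suc (f xs))"
proof -
  have "recn 1 (\<lambda>xs. Suc (hd xs))"
    unfolding recn_def by (rule exI[of _ S]) (auto simp: length_Suc_conv intro: ev_S)
  from recn_comp1[OF this assms] show ?thesis by simp
qed

lemma recn_const: "recn k (\<lambda>_. c)"
proof (induction c)
  case 0
  show ?case unfolding recn_def by (rule exI[of _ Z]) (auto intro: ev_Z)
next
  case (Suc c)
  then show ?case by (rule recn_Suc)
qed

lemma recn_rec:
  assumes "recn k f" "recn (Suc (Suc k)) g"
  shows "recn (Suc k) (\<lambda>xs. rec_nat (f (tl xs)) (\<lambda>n z. g (n # z # tl xs)) (hd xs))"
proof -
  from assms obtain rf rg where
    rf: "\<And>xs. length xs = k \<Longrightarrow> eval_rf rf xs (f xs)" and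
    rg: "\<And>xs. length xs = Suc (Suc k) \<Longrightarrow> eval_rf rg xs (g xs)"
    by (auto simp: recn_def)
  have "eval_rf (Pr rf rg) (x # xs) (rec_nat (f xs) (\<lambda>n z. g (n # z # xs)) x)"
    if "length xs = k" for x xs
  proof (induction x)
    case 0
    show ?case using rf[OF that] by (auto intro: ev_Pr0)
  next
    case (Suc x)
    show ?case
      by (simp, rule ev_PrS[OF Suc]) (rule rg, simp add: that)
  qed
  then show ?thesis
    unfolding recn_def by (intro exI[of _ "Pr rf rg"]) (auto simp: length_Suc_conv)
qed

lemma recn_rec1:
  assumes "recn 2 g"
  shows "recn 1 (\<lambda>xs. rec_nat c (\<lambda>n z. g [n, z]) (xs ! 0))"
proof -
  have "recn 2 (\<lambda>xs. g [xs ! 0, xs ! 1])"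
    using assms by (intro recn_comp2 recn_nth) auto
  with recn_const have "recn 1 (\<lambda>xs. rec_nat c (\<lambda>n z. g [n, z]) (hd xs))"
    using recn_rec[of 0 "\<lambda>_. c" "\<lambda>xs. g [xs ! 0, xs ! 1]"] by (simp add: numeral_2_eq_2)
  then show ?thesis
    by (rule recn_cong) (auto simp: length_Suc_conv)
qed

lemma length_2_conv: "length xs = 2 \<longleftrightarrow> (\<exists>x y. xs = [x, y])"
  by (auto simp: length_Suc_conv numeral_2_eq_2)

lemma recn_add:
  assumes "recn k f" "recn k g"
  shows "recn k (\<lambda>xs. f xs + g xs)"
proof -
  have "recn 2 (\<lambda>xs. rec_nat (tl xs ! 0) (\<lambda>n z. Suc ((n # z # tl xs) ! 1)) (hd xs))"
    using recn_rec[of 1 "\<lambda>xs. xs ! 0" "\<lambda>xs. Suc (xs ! 1)"]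
    by (simp add: recn_nth recn_Suc numeral_2_eq_2)
  moreover have "rec_nat y (\<lambda>n z. Suc z) x = x + y" for x y :: nat
    by (induction x) auto
  ultimately have "recn 2 (\<lambda>xs. xs ! 0 + xs ! 1)"
    by (elim recn_cong) (auto simp: length_2_conv)
  from recn_comp2[OF this assms] show ?thesis by simp
qed

lemma recn_diff:
  assumes "recn k f" "recn k g"
  shows "recn k (\<lambda>xs. f xs - g xs)"
proof -
  \<comment> \<open>The predecessor is a primitive recursion that returns its index and ignores the
    accumulator.\<close>
  have "recn 1 (\<lambda>xs. rec_nat 0 (\<lambda>n z. [n, z] ! 0) (xs ! 0))"
    by (intro recn_rec1 recn_nth) auto
  moreover have "rec_nat 0 (\<lambda>n z. n) x = x - 1" for x :: nat
    by (cases x) auto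
  ultimately have pred: "recn 1 (\<lambda>xs. xs ! 0 - 1)"
    by (elim recn_cong) auto
  have "recn 3 (\<lambda>xs. xs ! 1 - 1)"
    using recn_comp1[OF pred recn_nth[of 1 3]] by simp
  then have "recn 2 (\<lambda>xs. rec_nat (tl xs ! 0) (\<lambda>n z. (n # z # tl xs) ! 1 - 1) (hd xs))"
    using recn_rec[of 1 "\<lambda>xs. xs ! 0" "\<lambda>xs. xs ! 1 - 1"]
    by (simp add: recn_nth numeral_2_eq_2 numeral_3_eq_3)
  moreover have "rec_nat y (\<lambda>n z. z - 1) x = y - x" for x y :: nat
    by (induction x) auto
  ultimately have "recn 2 (\<lambda>xs. xs ! 1 - xs ! 0)"
    by (elim recn_cong) (auto simp: length_2_conv)
  \<comment> \<open>Primitive recursion runs on the first argument, which is the subtrahend here,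
    hence the swapped order.\<close>
  from recn_comp2[OF this assms(2,1)] show ?thesis by simp
qed

section \<open>Pairing and its inverse\<close>

lemma recn_triangle:
  assumes "recn k f"
  shows "recn k (\<lambda>xs. triangle (f xs))"
proof -
  have "recn 1 (\<lambda>xs. rec_nat 0 (\<lambda>n z. [n, z] ! 1 + Suc ([n, z] ! 0)) (xs ! 0))"
    by (intro recn_rec1 recn_add recn_Suc recn_nth) auto
  moreover have "rec_nat 0 (\<lambda>n z. z + Suc n) x = triangle x" for x :: nat
    by (induction x) auto
  ultimately have "recn 1 (\<lambda>xs. triangle (xs ! 0))"
    by (elim recn_cong) auto
  from recn_comp1[OF this assms] show ?thesis by simp
qed

text \<open>Maps the code of a pair \<open>(a, b)\<close> to \<open>a + b\<close>.\<close>

definition diagonal :: "nat \<Rightarrow> nat" where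
  "diagonal = rec_nat 0 (\<lambda>n z. z + (1 - (triangle (Suc z) - Suc n)))"

text \<open>From one code to the next the diagonal grows by at most one. The nested truncated
  difference in \<open>diagonal\<close> is 1 exactly when the next code reaches the next triangular
  number, so no search is involved.\<close>

lemma diagonal_bounds: "triangle (diagonal z) \<le> z \<and> z < triangle (Suc (diagonal z))"
proof (induction z)
  case 0
  show ?case by (simp add: diagonal_def)
next
  case (Suc z)
  have eq: "diagonal (Suc z) = diagonal z + (1 - (triangle (Suc (diagonal z)) - Suc z))"
    by (simp add: diagonal_def)
  show ?case
  proof (cases "triangle (Suc (diagonal z)) \<le> Suc z")
    case True
    with eq have "diagonal (Suc z) = Suc (diagonal z)" by simp
    with Suc True show ?thesis by simp
  next
    case False
    with eq have "diagonal (Suc z) = diagonal z" by simp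
    with Suc False show ?thesis by simp
  qed
qed

lemma diagonal_prod_encode: "diagonal (prod_encode (a, b)) = a + b"
proof -
  have mono: "triangle m \<le> triangle n" if "m \<le> n" for m n
    using that by (induction rule: dec_induct) auto
  have "triangle (a + b) \<le> prod_encode (a, b) \<and> prod_encode (a, b) < triangle (Suc (a + b))"
    by (simp add: prod_encode_def)
  with diagonal_bounds[of "prod_encode (a, b)"]
    mono[of "Suc (a + b)" "diagonal (prod_encode (a, b))"]
    mono[of "Suc (diagonal (prod_encode (a, b)))" "a + b"]
  show ?thesis by linarith
qed

definition pfst :: "nat \<Rightarrow> nat" where "pfst z = fst (prod_decode z)"
definition psnd :: "nat \<Rightarrow> nat" where "psnd z = snd (prod_decode z)"

lemma pfst_pair [simp]: "pfst (prod_encode (a, b)) = a"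
  and psnd_pair [simp]: "psnd (prod_encode (a, b)) = b"
  by (simp_all add: pfst_def psnd_def)

text \<open>A pair code has the form \<open>triangle (a + b) + a\<close>, so the diagonal
  \<open>a + b\<close> yields both components by subtraction.\<close>

lemma pfst_eq: "pfst z = z - triangle (diagonal z)"
  and psnd_eq: "psnd z = diagonal z - pfst z"
proof -
  obtain a b where z: "z = prod_encode (a, b)"
    by (metis prod_decode_inverse surj_pair)
  show "pfst z = z - triangle (diagonal z)" and "psnd z = diagonal z - pfst z"
    by (simp_all add: z diagonal_prod_encode) (simp add: prod_encode_def)
qed

section \<open>Unary recursive functions and recursive predicates\<close>

lemma recursive_iff: "recursive f \<longleftrightarrow> recn 1 (\<lambda>xs. f (xs ! 0))"
  unfolding recursive_def recn_def
  by (intro ex_cong1) (auto simp: length_Suc_conv)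

named_theorems rec_intros

lemma recursive_id [rec_intros]: "recursive (\<lambda>e. e)"
  by (simp add: recursive_iff recn_nth)

lemma recursive_const [rec_intros]: "recursive (\<lambda>e. c)"
  by (simp add: recursive_iff recn_const)

lemma recursive_comp: "recursive f \<Longrightarrow> recursive g \<Longrightarrow> recursive (\<lambda>e. f (g e))"
  unfolding recursive_iff using recn_comp1[of "\<lambda>xs. f (xs ! 0)" 1 "\<lambda>xs. g (xs ! 0)"] by simp

lemma recursive_Suc [rec_intros]: "recursive f \<Longrightarrow> recursive (\<lambda>e. Suc (f e))"
  unfolding recursive_iff by (rule recn_Suc)

lemma recursive_add [rec_intros]: "recursive f \<Longrightarrow> recursive g \<Longrightarrow> recursive (\<lambda>e. f e + g e)"
  unfolding recursive_iff by (rule recn_add)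

lemma recursive_diff [rec_intros]: "recursive f \<Longrightarrow> recursive g \<Longrightarrow> recursive (\<lambda>e. f e - g e)"
  unfolding recursive_iff by (rule recn_diff)

lemma recn_prod_encode: "recn k f \<Longrightarrow> recn k g \<Longrightarrow> recn k (\<lambda>xs. prod_encode (f xs, g xs))"
  unfolding prod_encode_def prod.case by (intro recn_add recn_triangle)

lemma recursive_pair [rec_intros]:
  "recursive f \<Longrightarrow> recursive g \<Longrightarrow> recursive (\<lambda>e. prod_encode (f e, g e))"
  unfolding recursive_iff by (rule recn_prod_encode)

lemma recursive_diagonal: "recursive diagonal"
proof -
  have "recn 1 (\<lambda>xs. rec_nat 0 (\<lambda>n z. [n, z] ! 1 + (1 - (triangle (Suc ([n, z] ! 1)) - Suc ([n, z] ! 0)))) (xs ! 0))"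
    by (intro recn_rec1 recn_add recn_diff recn_triangle recn_const recn_Suc recn_nth) auto
  then show ?thesis
    unfolding recursive_iff by (rule recn_cong) (simp add: diagonal_def)
qed

lemma recursive_pfst [rec_intros]: "recursive f \<Longrightarrow> recursive (\<lambda>e. pfst (f e))"
proof (rule recursive_comp[of pfst])
  show "recursive pfst"
    using recn_diff[OF recn_nth[of 0 1] recn_triangle[OF recursive_diagonal[unfolded recursive_iff]]]
    by (simp add: recursive_iff pfst_eq)
qed

lemma recursive_psnd [rec_intros]: "recursive f \<Longrightarrow> recursive (\<lambda>e. psnd (f e))"
proof (rule recursive_comp[of psnd])
  show "recursive psnd"
    unfolding psnd_eq by (intro rec_intros recursive_diagonal)
qed

lemma recursive_comp2:
  assumes "recursive (\<lambda>e. F (pfst e) (psnd e))" "recursive f" "recursive g"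
  shows "recursive (\<lambda>e. F (f e) (g e))"
  using recursive_comp[OF assms(1) recursive_pair[OF assms(2,3)]] by simp

text \<open>A function of several arguments is recursive if it is so in the nested pair of its
  arguments; bound variables are pushed in front of the environment \<open>e\<close>.\<close>

lemma recursive_rec [rec_intros]:
  assumes f: "recursive f" and b: "recursive b"
    and g: "recursive (\<lambda>e. g (pfst e) (pfst (psnd e)) (psnd (psnd e)))"
  shows "recursive (\<lambda>e. rec_nat (f e) (\<lambda>n z. g n z e) (b e))"
proof -
  let ?h = "\<lambda>e. g (pfst e) (pfst (psnd e)) (psnd (psnd e))"
  have "recn 3 (\<lambda>xs. ?h ([prod_encode (xs ! 0, prod_encode (xs ! 1, xs ! 2))] ! 0))"
    using recn_comp1[OF g[unfolded recursive_iff],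
      of 3 "\<lambda>xs. prod_encode (xs ! 0, prod_encode (xs ! 1, xs ! 2))"]
    by (simp add: recn_prod_encode recn_nth)
  then have h: "recn (Suc (Suc 1)) (\<lambda>xs. g (xs ! 0) (xs ! 1) (xs ! 2))"
    by (simp add: numeral_3_eq_3)
  have "recn 2 (\<lambda>xs. rec_nat (f (tl xs ! 0)) (\<lambda>n z. g n z (tl xs ! 0)) (hd xs))"
    using recn_rec[OF f[unfolded recursive_iff] h] by (simp add: numeral_2_eq_2)
  from recn_comp2[OF this b[unfolded recursive_iff] recn_nth[of 0 1]]
  show ?thesis by (simp add: recursive_iff)
qed

lemma recursive_mult [rec_intros]:
  assumes "recursive f" "recursive g"
  shows "recursive (\<lambda>e. f e * g e)"
proof -
  have eq: "rec_nat 0 (\<lambda>_ z. z + y) x = x * y" for x y :: nat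
    by (induction x) auto
  \<comment> \<open>Under the recursor the environment is \<open>psnd (psnd e)\<close>;
    \<open>recursive_comp\<close> reduces the resulting composition with \<open>g\<close> to the
    assumption on \<open>g\<close>.\<close>
  have "recursive (\<lambda>e. rec_nat 0 (\<lambda>_ z. z + g e) (f e))"
    using assms by (intro rec_intros recursive_comp[OF assms(2)])
  then show ?thesis unfolding eq .
qed

lemma recursive_power [rec_intros]:
  assumes "recursive f" "recursive g"
  shows "recursive (\<lambda>e. f e ^ g e)"
proof -
  have eq: "rec_nat 1 (\<lambda>_ z. z * y) x = y ^ x" for x y :: nat
    by (induction x) auto
  have "recursive (\<lambda>e. rec_nat 1 (\<lambda>_ z. z * f e) (g e))"
    using assms by (intro rec_intros recursive_comp[OF assms(1)])
  then show ?thesis unfolding eq .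
qed

definition recursive_pred :: "(nat \<Rightarrow> bool) \<Rightarrow> bool" where
  "recursive_pred P \<longleftrightarrow> recursive (\<lambda>e. if P e then 1 else 0)"

lemma recursive_pred_comp2:
  assumes "recursive_pred (\<lambda>e. P (pfst e) (psnd e))" "recursive f" "recursive g"
  shows "recursive_pred (\<lambda>e. P (f e) (g e))"
  using recursive_comp[OF assms(1)[unfolded recursive_pred_def] recursive_pair[OF assms(2,3)]]
  by (simp add: recursive_pred_def)

lemma recursive_if [rec_intros]:
  assumes "recursive_pred P" "recursive f" "recursive g"
  shows "recursive (\<lambda>e. if P e then f e else g e)"
proof -
  have "recursive (\<lambda>e. (if P e then 1 else 0) * f e + (1 - (if P e then 1 else 0)) * g e)"
    using assms unfolding recursive_pred_def by (intro rec_intros)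
  then show ?thesis by (rule back_subst[of recursive]) auto
qed

lemma recursive_pred_less [rec_intros]:
  assumes "recursive f" "recursive g"
  shows "recursive_pred (\<lambda>e. f e < g e)"
proof -
  have "recursive (\<lambda>e. 1 - (1 - (g e - f e)))"
    using assms by (intro rec_intros)
  then show ?thesis
    unfolding recursive_pred_def by (rule back_subst[of recursive]) auto
qed

lemma recursive_pred_not [rec_intros]:
  assumes "recursive_pred P"
  shows "recursive_pred (\<lambda>e. \<not> P e)"
proof -
  have "recursive (\<lambda>e. 1 - (if P e then 1 else 0))"
    by (rule recursive_diff[OF recursive_const assms[unfolded recursive_pred_def]])
  then show ?thesis
    unfolding recursive_pred_def by (rule back_subst[of recursive]) auto
qed

lemma recursive_pred_conj [rec_intros]:
  assumes "recursive_pred P" "recursive_pred Q"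
  shows "recursive_pred (\<lambda>e. P e \<and> Q e)"
proof -
  have "recursive (\<lambda>e. (if P e then 1 else 0) * (if Q e then 1 else 0))"
    by (rule recursive_mult[OF assms[unfolded recursive_pred_def]])
  then show ?thesis
    unfolding recursive_pred_def by (rule back_subst[of recursive]) auto
qed

lemma recursive_pred_disj [rec_intros]:
  assumes "recursive_pred P" "recursive_pred Q"
  shows "recursive_pred (\<lambda>e. P e \<or> Q e)"
proof -
  have "recursive_pred (\<lambda>e. \<not> (\<not> P e \<and> \<not> Q e))"
    using assms by (intro rec_intros)
  then show ?thesis by simp
qed

lemma recursive_pred_imp [rec_intros]:
  assumes "recursive_pred P" "recursive_pred Q"
  shows "recursive_pred (\<lambda>e. P e \<longrightarrow> Q e)"
  unfolding imp_conv_disj using assms by (intro recursive_pred_disj recursive_pred_not)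

lemma recursive_pred_le [rec_intros]:
  "recursive f \<Longrightarrow> recursive g \<Longrightarrow> recursive_pred (\<lambda>e. f e \<le> g e)"
  using recursive_pred_not[OF recursive_pred_less[of g f]] by (simp add: not_less)

lemma recursive_pred_eq [rec_intros]:
  "recursive f \<Longrightarrow> recursive g \<Longrightarrow> recursive_pred (\<lambda>e. f e = g e)"
  unfolding order_eq_iff by (intro rec_intros)

lemma recursive_pred_ex [rec_intros]:
  assumes "recursive b" "recursive_pred (\<lambda>e. P (pfst e) (psnd e))"
  shows "recursive_pred (\<lambda>e. \<exists>i<b e. P i e)"
proof -
  have eq: "rec_nat 0 (\<lambda>i z. if P i e then 1 else z) n = (if \<exists>i<n. P i e then 1 else 0::nat)" for e n
    by (induction n) (auto simp: less_Suc_eq)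
  \<comment> \<open>The recursor also packs its accumulator, so the environment sits one
    \<open>psnd\<close> deeper than in the assumption on \<open>P\<close>.\<close>
  have "recursive_pred (\<lambda>e. P (pfst e) (psnd (psnd e)))"
    by (rule recursive_pred_comp2[OF assms(2)]) (intro rec_intros)+
  then have "recursive (\<lambda>e. rec_nat 0 (\<lambda>i z. if P i e then 1 else z) (b e))"
    using assms(1) by (intro rec_intros)
  then show ?thesis
    unfolding recursive_pred_def eq .
qed

lemma recursive_pred_all [rec_intros]:
  assumes "recursive b" "recursive_pred (\<lambda>e. P (pfst e) (psnd e))"
  shows "recursive_pred (\<lambda>e. \<forall>i<b e. P i e)"
proof -
  have "recursive_pred (\<lambda>e. \<not> (\<exists>i<b e. \<not> P i e))"
    using assms by (intro rec_intros)
  then show ?thesis by simp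
qed

text \<open>The quotient is the number of \<open>i\<close> with \<open>Suc i * y \<le> x\<close>;
  counting below \<open>x\<close> suffices since \<open>x div y \<le> x\<close>. The test
  \<open>0 < y\<close> gives 0 for divisor 0, as \<open>div\<close> does.\<close>

lemma recursive_div [rec_intros]:
  assumes "recursive f" "recursive g"
  shows "recursive (\<lambda>e. f e div g e)"
proof -
  have aux: "rec_nat 0 (\<lambda>i z. if 0 < y \<and> Suc i * y \<le> x then Suc z else z) b = min b (x div y)"
    for b x y :: nat
  proof (induction b)
    case (Suc b)
    have "0 < y \<and> Suc b * y \<le> x \<longleftrightarrow> Suc b \<le> x div y"
      by (cases "y = 0") (simp_all add: less_eq_div_iff_mult_less_eq)
    with Suc show ?case by simp
  qed auto
  have eq: "rec_nat 0 (\<lambda>i z. if 0 < y \<and> Suc i * y \<le> x then Suc z else z) x = x div y"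
    for x y :: nat
    unfolding aux by simp
  have "recursive (\<lambda>e. rec_nat 0
      (\<lambda>i z. if 0 < g e \<and> Suc i * g e \<le> f e then Suc z else z) (f e))"
    using assms by (intro rec_intros recursive_comp[OF assms(1)] recursive_comp[OF assms(2)])
  then show ?thesis unfolding eq .
qed

lemma recursive_mod [rec_intros]:
  "recursive f \<Longrightarrow> recursive g \<Longrightarrow> recursive (\<lambda>e. f e mod g e)"
  unfolding modulo_nat_def by (intro rec_intros)

section \<open>Coding of words and lists by numbers\<close>

definition digit :: "nat \<Rightarrow> nat \<Rightarrow> nat \<Rightarrow> nat" where
  "digit b c i = c div b ^ i mod b"

lemma recursive_digit [rec_intros]:
  "recursive b \<Longrightarrow> recursive c \<Longrightarrow> recursive i \<Longrightarrow> recursive (\<lambda>e. digit (b e) (c e) (i e))"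
  unfolding digit_def by (intro rec_intros)

lemma digit_less: "0 < b \<Longrightarrow> digit b c i < b"
  by (simp add: digit_def)

text \<open>Horner's scheme with the lowest digit first: the head becomes the unit digit and the
  code of the tail is multiplied by the base.\<close>

lemma ex_digits:
  assumes "\<And>i. i < m \<Longrightarrow> s i < b"
  shows "\<exists>c < b ^ m. \<forall>i<m. digit b c i = s i"
  using assms
proof (induction m arbitrary: s)
  case (Suc m)
  from Suc.IH[of "\<lambda>i. s (Suc i)"] Suc.prems obtain c where
    c: "c < b ^ m" "\<And>i. i < m \<Longrightarrow> digit b c i = s (Suc i)" by auto
  have s0: "s 0 < b" using Suc.prems by simp
  have "digit b (s 0 + b * c) i = s i" if "i < Suc m" for i
  proof (cases i)
    case 0
    then show ?thesis using s0 by (simp add: digit_def)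
  next
    case (Suc j)
    have "(s 0 + b * c) div b ^ i = c div b ^ j"
      using s0 by (simp add: Suc div_mult2_eq)
    then show ?thesis using c(2)[of j] that by (simp add: digit_def Suc)
  qed
  moreover have "s 0 + b * c < b ^ Suc m"
  proof -
    have "s 0 + b * c < b + b * c" using s0 by simp
    also have "\<dots> = b * Suc c" by simp
    also have "\<dots> \<le> b * b ^ m" using c(1) by (intro mult_left_mono) auto
    finally show ?thesis by simp
  qed
  ultimately show ?case by blast
qed auto

text \<open>\<open>list_encode\<close> maps a nonempty list to the successor of the pair of its head
  and the code of its tail. Hence \<open>psnd (z - 1)\<close> drops the head and
  \<open>pfst (z - 1)\<close> reads it.\<close>

definition nth_code :: "nat \<Rightarrow> nat \<Rightarrow> nat" where
  "nth_code l i = pfst (rec_nat l (\<lambda>_ z. psnd (z - 1)) i - 1)"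

lemma recursive_nth_code [rec_intros]:
  "recursive l \<Longrightarrow> recursive i \<Longrightarrow> recursive (\<lambda>e. nth_code (l e) (i e))"
proof (rule recursive_comp2[of nth_code])
  show "recursive (\<lambda>e. nth_code (pfst e) (psnd e))"
    unfolding nth_code_def by (intro rec_intros)
qed

lemma nth_code_list_encode:
  assumes "i < length xs"
  shows "nth_code (list_encode xs) i = xs ! i"
proof -
  have "rec_nat (list_encode xs) (\<lambda>_ z. psnd (z - 1)) i = list_encode (drop i xs)"
    using assms
  proof (induction i)
    case (Suc i)
    then have "drop i xs = xs ! i # drop (Suc i) xs" by (simp add: Cons_nth_drop_Suc)
    with Suc show ?case by simp
  qed simp
  moreover have "drop i xs = xs ! i # drop (Suc i) xs"
    using assms by (simp add: Cons_nth_drop_Suc)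
  ultimately show ?thesis by (simp add: nth_code_def)
qed

lemma nth_code_enc_list: "i < length xs \<Longrightarrow> nth_code (enc_list e xs) i = e (xs ! i)"
  by (simp add: enc_list_def nth_code_list_encode)

section \<open>Hitting a target in a probabilistic automaton\<close>

lemma sum_pos_iff:
  fixes f :: "'a \<Rightarrow> 'b :: ordered_comm_monoid_add"
  assumes "finite A" "\<And>x. x \<in> A \<Longrightarrow> 0 \<le> f x"
  shows "0 < sum f A \<longleftrightarrow> (\<exists>x\<in>A. 0 < f x)"
  using assms sum_nonneg_eq_0_iff[of A f] sum_nonneg[of A f] by (auto simp: less_le)

text \<open>\<open>T\<close> marks the target edges. Keeping it arbitrary lets the same theory be
  instantiated at every real threshold.\<close>

locale target_automaton =
  fixes n k :: nat and I :: "nat \<Rightarrow> real" and d :: "nat \<Rightarrow> nat \<Rightarrow> nat \<Rightarrow> real"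
    and T :: "nat \<Rightarrow> nat \<Rightarrow> nat \<Rightarrow> bool"
  assumes letters: "0 < k"
    and I_nonneg: "\<And>q. q < n \<Longrightarrow> 0 \<le> I q"
    and I_sum: "(\<Sum>q<n. I q) = 1"
    and d_nonneg: "\<And>q a q'. q < n \<Longrightarrow> a < k \<Longrightarrow> q' < n \<Longrightarrow> 0 \<le> d q a q'"
    and d_sum: "\<And>q a. q < n \<Longrightarrow> a < k \<Longrightarrow> (\<Sum>q'<n. d q a q') = 1"
begin

section \<open>Hitting and avoiding along finite words\<close>

primrec hit :: "nat \<Rightarrow> nat list \<Rightarrow> bool" where
  "hit q [] = False"
| "hit q (a # u) = (\<exists>q'<n. 0 < d q a q' \<and> (T q a q' \<or> hit q' u))"

text \<open>Both predicates quantify existentially over paths, so \<open>hit q u\<close> and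
  \<open>surv q u p\<close> may hold together; neither is the negation of the other.\<close>

primrec surv :: "nat \<Rightarrow> nat list \<Rightarrow> nat \<Rightarrow> bool" where
  "surv q [] p = (q = p)"
| "surv q (a # u) p = (\<exists>q'<n. 0 < d q a q' \<and> \<not> T q a q' \<and> surv q' u p)"

primrec avoid_prob :: "nat \<Rightarrow> nat list \<Rightarrow> real" where
  "avoid_prob q [] = 1"
| "avoid_prob q (a # u) = (\<Sum>q'<n. d q a q' * of_bool (\<not> T q a q') * avoid_prob q' u)"

text \<open>The entries of the product, along the word, of the substochastic matrices left after
  deleting the target edges; their row sums are \<open>avoid_prob\<close>.\<close>

primrec surv_prob :: "nat \<Rightarrow> nat list \<Rightarrow> nat \<Rightarrow> real" where
  "surv_prob q [] p = of_bool (q = p)"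
| "surv_prob q (a # u) p = (\<Sum>q'<n. d q a q' * of_bool (\<not> T q a q') * surv_prob q' u p)"

definition avoid :: "nat list \<Rightarrow> real" where
  "avoid u = (\<Sum>q<n. I q * avoid_prob q u)"

abbreviation W :: "nat list set" where
  "W \<equiv> lists {..<k}"

lemma hit_append: "q < n \<Longrightarrow> hit q (u @ v) \<longleftrightarrow> hit q u \<or> (\<exists>q'<n. surv q u q' \<and> hit q' v)"
  by (induction u arbitrary: q) auto

lemma surv_append: "q < n \<Longrightarrow> surv q (u @ v) p \<longleftrightarrow> (\<exists>q'<n. surv q u q' \<and> surv q' v p)"
  by (induction u arbitrary: q) (auto, blast)

lemma avoid_prob_bounds: "u \<in> W \<Longrightarrow> q < n \<Longrightarrow> 0 \<le> avoid_prob q u \<and> avoid_prob q u \<le> 1"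
proof (induction u arbitrary: q)
  case (Cons a u)
  have a: "a < k" and u: "u \<in> W" using Cons.prems by auto
  have "(\<Sum>q'<n. d q a q' * of_bool (\<not> T q a q') * avoid_prob q' u) \<le> (\<Sum>q'<n. d q a q')"
    using Cons.IH[OF u] d_nonneg[OF Cons.prems(2) a]
    by (intro sum_mono) (auto intro!: mult_left_le)
  moreover have "0 \<le> (\<Sum>q'<n. d q a q' * of_bool (\<not> T q a q') * avoid_prob q' u)"
    using Cons.IH[OF u] d_nonneg[OF Cons.prems(2) a] by (intro sum_nonneg) auto
  ultimately show ?case using d_sum[OF Cons.prems(2) a] by simp
qed simp

lemma avoid_prob_eq_1:
  "u \<in> W \<Longrightarrow> q < n \<Longrightarrow> \<not> hit q u \<Longrightarrow> avoid_prob q u = 1"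
proof (induction u arbitrary: q)
  case (Cons a u)
  have a: "a < k" and u: "u \<in> W" using Cons.prems by auto
  have *: "d q a q' * of_bool (\<not> T q a q') * avoid_prob q' u = d q a q'" if "q' < n" for q'
  proof (cases "d q a q' = 0")
    case False
    then have "0 < d q a q'" using d_nonneg[OF Cons.prems(2) a that] by simp
    with Cons.prems(3) that have "\<not> T q a q'" "\<not> hit q' u" by auto
    with Cons.IH[OF u that] show ?thesis by simp
  qed simp
  have "avoid_prob q (a # u) = (\<Sum>q'<n. d q a q')"
    unfolding avoid_prob.simps by (rule sum.cong) (auto simp: *)
  then show ?case using d_sum[OF Cons.prems(2) a] by simp
qed simp

text \<open>Some hitting path exists and each of its edges has probability at least
  \<open>p\<close>, so a hit has probability at least \<open>p ^ length u\<close>. A path that hits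
  early uses fewer edges, which \<open>p \<le> 1\<close> absorbs.\<close>

lemma avoid_prob_le:
  assumes p: "0 < p" "p \<le> 1"
    "\<And>q a q'. q < n \<Longrightarrow> a < k \<Longrightarrow> q' < n \<Longrightarrow> 0 < d q a q' \<Longrightarrow> p \<le> d q a q'"
  shows "u \<in> W \<Longrightarrow> q < n \<Longrightarrow> hit q u \<Longrightarrow> avoid_prob q u \<le> 1 - p ^ length u"
proof (induction u arbitrary: q)
  case (Cons a u)
  have a: "a < k" and u: "u \<in> W" using Cons.prems by auto
  from Cons.prems obtain q1 where q1: "q1 < n" "0 < d q a q1" "T q a q1 \<or> hit q1 u" by auto
  \<comment> \<open>\<open>x q'\<close> is the probability of avoiding after a move to
    \<open>q'\<close>; since the row sums to one, the probability of a hit is the average of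
    \<open>1 - x q'\<close>.\<close>
  define x where "x q' = of_bool (\<not> T q a q') * avoid_prob q' u" for q'
  have x_le: "x q' \<le> 1" if "q' < n" for q'
    using avoid_prob_bounds[OF u that] by (simp add: x_def)
  have x1: "x q1 \<le> 1 - p ^ length u"
    using q1(3) Cons.IH[OF u q1(1)] p by (auto simp: x_def power_le_one)
  have "p * p ^ length u \<le> d q a q1 * (1 - x q1)"
    using p q1 x1 a Cons.prems by (intro mult_mono) auto
  also have "\<dots> \<le> (\<Sum>q'<n. d q a q' * (1 - x q'))"
    using q1 x_le d_nonneg[OF Cons.prems(2) a]
    by (intro member_le_sum[of _ _ "\<lambda>q'. d q a q' * (1 - x q')"]) auto
  also have "\<dots> = 1 - avoid_prob q (a # u)"
    using d_sum[OF Cons.prems(2) a]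
    by (simp add: x_def algebra_simps sum_subtractf)
  finally show ?case by simp
qed simp

lemma surv_prob_nonneg: "u \<in> W \<Longrightarrow> q < n \<Longrightarrow> 0 \<le> surv_prob q u p"
  by (induction u arbitrary: q) (auto intro!: sum_nonneg mult_nonneg_nonneg d_nonneg)

lemma surv_prob_pos: "u \<in> W \<Longrightarrow> q < n \<Longrightarrow> 0 < surv_prob q u p \<longleftrightarrow> surv q u p"
proof (induction u arbitrary: q)
  case (Cons a u)
  have a: "a < k" and u: "u \<in> W" using Cons.prems by auto
  let ?f = "\<lambda>q'. d q a q' * of_bool (\<not> T q a q') * surv_prob q' u p"
  have nn: "0 \<le> ?f q'" if "q' < n" for q'
    using d_nonneg[OF Cons.prems(2) a that] surv_prob_nonneg[OF u that] by simp
  have "0 < sum ?f {..<n} \<longleftrightarrow> (\<exists>q'\<in>{..<n}. 0 < ?f q')"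
    using nn by (intro sum_pos_iff) auto
  also have "\<dots> \<longleftrightarrow> (\<exists>q'<n. 0 < d q a q' \<and> \<not> T q a q' \<and> surv q' u p)"
  proof -
    have "0 < ?f q' \<longleftrightarrow> 0 < d q a q' \<and> \<not> T q a q' \<and> surv q' u p" if "q' < n" for q'
      using d_nonneg[OF Cons.prems(2) a that] surv_prob_nonneg[OF u that] Cons.IH[OF u that]
      by (auto simp: zero_less_mult_iff)
    then show ?thesis by auto
  qed
  finally show ?case by simp
qed simp

text \<open>The Chapman-Kolmogorov equation for the substochastic matrices: a path over
  \<open>u @ v\<close> is split at the state reached after \<open>u\<close>.\<close>

lemma avoid_prob_append:
  "q < n \<Longrightarrow> avoid_prob q (u @ v) = (\<Sum>p<n. surv_prob q u p * avoid_prob p v)"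
proof (induction u arbitrary: q)
  case Nil
  have "(\<Sum>p<n. surv_prob q [] p * avoid_prob p v) = (\<Sum>p\<in>{q}. avoid_prob p v)"
    using Nil by (intro sum.mono_neutral_cong_right) auto
  then show ?case by simp
next
  case (Cons a u)
  have "avoid_prob q ((a # u) @ v) = (\<Sum>q'<n. d q a q' * of_bool (\<not> T q a q') *
      (\<Sum>p<n. surv_prob q' u p * avoid_prob p v))"
    using Cons.IH by simp
  also have "\<dots> = (\<Sum>p<n. surv_prob q (a # u) p * avoid_prob p v)"
    by (simp add: sum_distrib_left sum_distrib_right mult.assoc) (rule sum.swap)
  finally show ?case .
qed

lemma avoid_prob_eq_sum: "q < n \<Longrightarrow> avoid_prob q u = (\<Sum>p<n. surv_prob q u p)"
  using avoid_prob_append[of q u "[]"] by simp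

lemma avoid_le_1: "u \<in> W \<Longrightarrow> avoid u \<le> 1"
proof -
  assume u: "u \<in> W"
  have "avoid u \<le> (\<Sum>q<n. I q)"
    unfolding avoid_def using avoid_prob_bounds[OF u] I_nonneg
    by (intro sum_mono) (auto intro!: mult_left_le)
  then show ?thesis using I_sum by simp
qed

lemma avoid_nonneg: "u \<in> W \<Longrightarrow> 0 \<le> avoid u"
  unfolding avoid_def using avoid_prob_bounds I_nonneg by (intro sum_nonneg) auto

lemma pos_lower_bound:
  obtains p where "0 < p" "p \<le> 1"
    "\<And>q a q'. q < n \<Longrightarrow> a < k \<Longrightarrow> q' < n \<Longrightarrow> 0 < d q a q' \<Longrightarrow> p \<le> d q a q'"
proof -
  \<comment> \<open>Inserting 1 keeps the finite set nonempty and makes its minimum at most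
    1.\<close>
  let ?D = "insert 1 {x \<in> (\<lambda>(q, a, q'). d q a q') ` ({..<n} \<times> {..<k} \<times> {..<n}). 0 < x}"
  have fin: "finite ?D" by simp
  then have "0 < Min ?D" by (subst Min_gr_iff) auto
  moreover have "Min ?D \<le> 1" using fin by (intro Min_le) auto
  moreover have "Min ?D \<le> d q a q'" if "q < n" "a < k" "q' < n" "0 < d q a q'" for q a q'
    using fin that by (intro Min_le) (auto simp: image_iff)
  ultimately show ?thesis using that by blast
qed

text \<open>The decay over one block: from any survivor of \<open>u\<close>, the block
  \<open>v\<close> is passed without a hit with probability at most \<open>1 - p ^ length v\<close>,
  a bound that does not depend on the survivor.\<close>

lemma avoid_append_le:
  assumes p: "0 < p" "p \<le> 1"
    "\<And>q a q'. q < n \<Longrightarrow> a < k \<Longrightarrow> q' < n \<Longrightarrow> 0 < d q a q' \<Longrightarrow> p \<le> d q a q'"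
    and u: "u \<in> W" and v: "v \<in> W"
    and hit: "\<And>q q'. q < n \<Longrightarrow> 0 < I q \<Longrightarrow> q' < n \<Longrightarrow> surv q u q' \<Longrightarrow> hit q' v"
  shows "avoid (u @ v) \<le> (1 - p ^ length v) * avoid u"
proof -
  have "I q * avoid_prob q (u @ v) \<le> (1 - p ^ length v) * (I q * avoid_prob q u)" if q: "q < n" for q
  proof (cases "I q = 0")
    case False
    then have Iq: "0 < I q" using I_nonneg[OF q] by simp
    have "surv_prob q u q' * avoid_prob q' v \<le> surv_prob q u q' * (1 - p ^ length v)" if q': "q' < n" for q'
    proof (cases "surv q u q'")
      case True
      then show ?thesis
        using avoid_prob_le[OF p v q' hit[OF q Iq q']] surv_prob_nonneg[OF u q]
        by (intro mult_left_mono) auto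
    next
      case False
      then have "surv_prob q u q' = 0"
        using surv_prob_pos[OF u q] surv_prob_nonneg[OF u q] by (metis less_le)
      then show ?thesis by simp
    qed
    then have "avoid_prob q (u @ v) \<le> (\<Sum>q'<n. surv_prob q u q' * (1 - p ^ length v))"
      unfolding avoid_prob_append[OF q] by (intro sum_mono) auto
    also have "\<dots> = (1 - p ^ length v) * avoid_prob q u"
      by (simp add: avoid_prob_eq_sum[OF q] mult.commute sum_distrib_left)
    finally show ?thesis using Iq by (simp add: mult.left_commute)
  qed simp
  then show ?thesis
    unfolding avoid_def sum_distrib_left by (intro sum_mono) auto
qed

section \<open>Hitting along infinite words\<close>

lemma stake_W: "sset w \<subseteq> {..<k} \<Longrightarrow> stake m w \<in> W"
  by (fastforce simp: sset_range set_conv_nth)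

lemma sset_sdrop: "sset w \<subseteq> A \<Longrightarrow> sset (sdrop m w) \<subseteq> A"
  by (auto simp: sset_range sdrop_snth)

lemma hit_mono: "q < n \<Longrightarrow> hit q (stake m w) \<Longrightarrow> m \<le> m' \<Longrightarrow> hit q (stake m' w)"
  by (metis hit_append le_add_diff_inverse stake_add)

text \<open>The limit is the probability of never hitting, as \<open>avoid_tendsto\<close> shows
  later. Defining it through finite prefixes keeps the combinatorics of infinite words free of
  measures.\<close>

definition as_hit :: "nat stream \<Rightarrow> bool" where
  "as_hit w \<longleftrightarrow> (\<lambda>m. avoid (stake m w)) \<longlonglongrightarrow> 0"

definition pos_hit :: "nat stream \<Rightarrow> bool" where
  "pos_hit w \<longleftrightarrow> (\<exists>m. avoid (stake m w) < 1)"

definition initial :: "nat set" where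
  "initial = {q. q < n \<and> 0 < I q}"

definition alive :: "nat list \<Rightarrow> nat set" where
  "alive u = {p. p < n \<and> (\<exists>q\<in>initial. surv q u p)}"

lemma alive_append: "alive (u @ v) = {p. p < n \<and> (\<exists>q\<in>alive u. surv q v p)}"
  unfolding alive_def initial_def by (auto simp: surv_append)

lemma avoid_eq_1_iff:
  assumes u: "u \<in> W"
  shows "avoid u = 1 \<longleftrightarrow> (\<forall>q\<in>initial. \<not> hit q u)"
proof -
  obtain p where p: "0 < p" "p \<le> 1"
    "\<And>q a q'. q < n \<Longrightarrow> a < k \<Longrightarrow> q' < n \<Longrightarrow> 0 < d q a q' \<Longrightarrow> p \<le> d q a q'"
    using pos_lower_bound by metis
  have "1 - avoid u = (\<Sum>q<n. I q * (1 - avoid_prob q u))"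
    by (simp add: avoid_def algebra_simps sum_subtractf I_sum)
  then have "avoid u = 1 \<longleftrightarrow> (\<Sum>q<n. I q * (1 - avoid_prob q u)) = 0" by linarith
  also have "\<dots> \<longleftrightarrow> (\<forall>q<n. I q = 0 \<or> avoid_prob q u = 1)"
    using I_nonneg avoid_prob_bounds[OF u] by (subst sum_nonneg_eq_0_iff) auto
  also have "\<dots> \<longleftrightarrow> (\<forall>q<n. I q = 0 \<or> \<not> hit q u)"
  proof -
    have "avoid_prob q u \<noteq> 1" if "q < n" "hit q u" for q
    proof -
      have "0 < p ^ length u" using p by simp
      with avoid_prob_le[OF p u that] show ?thesis by linarith
    qed
    with avoid_prob_eq_1[OF u] show ?thesis by blast
  qed
  also have "\<dots> \<longleftrightarrow> (\<forall>q\<in>initial. \<not> hit q u)"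
    using I_nonneg by (auto simp: initial_def less_le)
  finally show ?thesis .
qed

lemma pos_hit_iff:
  assumes w: "sset w \<subseteq> {..<k}"
  shows "pos_hit w \<longleftrightarrow> (\<exists>m. \<exists>q\<in>initial. hit q (stake m w))"
  using avoid_eq_1_iff[OF stake_W[OF w]] avoid_le_1[OF stake_W[OF w]]
  unfolding pos_hit_def by (metis less_le)

text \<open>A survivor from which no continuation hits traps the mass that reaches it:
  \<open>avoid\<close> never falls below \<open>?c\<close>, the probability of starting in some
  \<open>q0\<close> and reaching the survivor without a hit, and so cannot tend to 0.\<close>

lemma as_hitD:
  assumes w: "sset w \<subseteq> {..<k}" and lim: "as_hit w" and q: "q \<in> alive (stake i w)"
  shows "\<exists>j. hit q (stake j (sdrop i w))"
proof (rule ccontr)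
  assume no_hit: "\<nexists>j. hit q (stake j (sdrop i w))"
  from q obtain q0 where q0: "q0 < n" "0 < I q0" "surv q0 (stake i w) q" "q < n"
    by (auto simp: alive_def initial_def)
  let ?c = "I q0 * surv_prob q0 (stake i w) q"
  have "0 < ?c" using q0 surv_prob_pos[OF stake_W[OF w]] by simp
  have ge: "?c \<le> avoid (stake (i + j) w)" for j
  proof -
    let ?v = "stake j (sdrop i w)"
    have v: "?v \<in> W" by (intro stake_W sset_sdrop w)
    have nn: "0 \<le> surv_prob q0 (stake i w) p * avoid_prob p ?v" if "p < n" for p
      using surv_prob_nonneg[OF stake_W[OF w] q0(1)] avoid_prob_bounds[OF v that] by simp
    have "surv_prob q0 (stake i w) q = surv_prob q0 (stake i w) q * avoid_prob q ?v"
      using avoid_prob_eq_1[OF v q0(4)] no_hit by simp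
    also have "\<dots> \<le> (\<Sum>p<n. surv_prob q0 (stake i w) p * avoid_prob p ?v)"
      using q0 nn by (intro member_le_sum[of _ _ "\<lambda>p. surv_prob q0 (stake i w) p * avoid_prob p ?v"]) auto
    also have "\<dots> = avoid_prob q0 (stake (i + j) w)"
      using avoid_prob_append[OF q0(1)] by (simp flip: stake_add)
    finally have "?c \<le> I q0 * avoid_prob q0 (stake (i + j) w)"
      using q0(2) by simp
    also have "\<dots> \<le> avoid (stake (i + j) w)"
      unfolding avoid_def using q0 I_nonneg avoid_prob_bounds[OF stake_W[OF w]]
      by (intro member_le_sum[of _ _ "\<lambda>q. I q * avoid_prob q (stake (i + j) w)"]) auto
    finally show ?thesis .
  qed
  have "(\<lambda>j. avoid (stake (i + j) w)) \<longlonglongrightarrow> 0"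
    using LIMSEQ_ignore_initial_segment[OF lim[unfolded as_hit_def], of i] by (simp add: add.commute)
  then have "?c \<le> 0" by (rule LIMSEQ_le_const) (use ge in blast)
  with \<open>0 < ?c\<close> show False by simp
qed

lemma avoid_antimono:
  assumes w: "sset w \<subseteq> {..<k}" and "m \<le> m'"
  shows "avoid (stake m' w) \<le> avoid (stake m w)"
proof -
  obtain j where m': "m' = m + j" using \<open>m \<le> m'\<close> le_Suc_ex by blast
  have "I q * avoid_prob q (stake m' w) \<le> I q * avoid_prob q (stake m w)" if q: "q < n" for q
  proof -
    have v: "stake j (sdrop m w) \<in> W" by (intro stake_W sset_sdrop w)
    have "avoid_prob q (stake m' w) = (\<Sum>p<n. surv_prob q (stake m w) p * avoid_prob p (stake j (sdrop m w)))"
      using avoid_prob_append[OF q] by (simp add: m' flip: stake_add)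
    also have "\<dots> \<le> (\<Sum>p<n. surv_prob q (stake m w) p)"
      using surv_prob_nonneg[OF stake_W[OF w] q] avoid_prob_bounds[OF v]
      by (intro sum_mono) (auto intro!: mult_left_le)
    finally show ?thesis
      using I_nonneg[OF q] by (auto simp: avoid_prob_eq_sum[OF q] intro: mult_left_mono)
  qed
  then show ?thesis unfolding avoid_def by (intro sum_mono) auto
qed

lemma as_hitI:
  assumes w: "sset w \<subseteq> {..<k}"
    and hit: "\<And>i q. q \<in> alive (stake (t + i * L) w) \<Longrightarrow> hit q (stake L (sdrop (t + i * L) w))"
  shows "as_hit w"
proof -
  obtain p where p: "0 < p" "p \<le> 1"
    "\<And>q a q'. q < n \<Longrightarrow> a < k \<Longrightarrow> q' < n \<Longrightarrow> 0 < d q a q' \<Longrightarrow> p \<le> d q a q'"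
    using pos_lower_bound by metis
  define c where "c = 1 - p ^ L"
  have c: "0 \<le> c" "c < 1" using p by (auto simp: c_def power_le_one)
  have bound: "avoid (stake (t + i * L) w) \<le> c ^ i" for i
  proof (induction i)
    case 0
    show ?case using avoid_le_1[OF stake_W[OF w]] by simp
  next
    case (Suc i)
    let ?u = "stake (t + i * L) w" and ?v = "stake L (sdrop (t + i * L) w)"
    have "avoid (?u @ ?v) \<le> (1 - p ^ length ?v) * avoid ?u"
    proof (rule avoid_append_le[OF p])
      show "?u \<in> W" "?v \<in> W" by (intro stake_W sset_sdrop w)+
      show "hit q' ?v" if "q < n" "0 < I q" "q' < n" "surv q ?u q'" for q q'
        using that by (intro hit) (auto simp: alive_def initial_def)
    qed auto
    also have "\<dots> \<le> c * c ^ i"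
      using Suc c by (auto simp: c_def intro!: mult_left_mono)
    also have "?u @ ?v = stake (t + Suc i * L) w"
      unfolding stake_add by (simp add: algebra_simps)
    finally show ?case by simp
  qed
  have lim: "(\<lambda>i. c ^ i) \<longlonglongrightarrow> 0" using c by (intro LIMSEQ_realpow_zero) auto
  show ?thesis
    unfolding as_hit_def
  proof (rule LIMSEQ_I)
    fix e :: real assume "0 < e"
    from LIMSEQ_D[OF lim this] obtain i where i: "c ^ i < e"
      using c by auto
    \<comment> \<open>The geometric bound is known at block boundaries only; \<open>avoid\<close>
      decreases along prefixes, so every later length inherits it.\<close>
    have "norm (avoid (stake m w) - 0) < e" if "t + i * L \<le> m" for m
      using avoid_antimono[OF w that] bound[of i] i avoid_nonneg[OF stake_W[OF w], of m] by simp
    then show "\<exists>m0. \<forall>m\<ge>m0. norm (avoid (stake m w) - 0) < e" by blast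
  qed
qed

section \<open>Profiles and pumping\<close>

text \<open>The profile of a word determines how it acts on sets of states, whatever follows it;
  there are at most \<open>2 ^ (n * (n + 1))\<close> profiles. The second component \<open>n\<close> marks a hit.\<close>

definition profile :: "nat list \<Rightarrow> (nat \<times> nat) set" where
  "profile u = {(q, p). q < n \<and> p < n \<and> surv q u p} \<union> {(q, p). q < n \<and> p = n \<and> hit q u}"

definition profile_bound :: nat where
  "profile_bound = 2 ^ (n * (n + 1))"

lemma profile_eq_iff:
  "profile u = profile v \<longleftrightarrow> (\<forall>q<n. hit q u = hit q v \<and> (\<forall>p<n. surv q u p = surv q v p))"
proof -
  have "hit q u \<longleftrightarrow> (q, n) \<in> profile u" if "q < n" for q u
    using that by (simp add: profile_def)
  moreover have "surv q u p \<longleftrightarrow> (q, p) \<in> profile u" if "q < n" "p < n" for q p u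
    using that by (simp add: profile_def)
  ultimately have "profile u = profile v \<Longrightarrow> (\<forall>q<n. hit q u = hit q v \<and> (\<forall>p<n. surv q u p = surv q v p))"
    by blast
  moreover have "(\<forall>q<n. hit q u = hit q v \<and> (\<forall>p<n. surv q u p = surv q v p)) \<Longrightarrow> profile u = profile v"
    unfolding profile_def by auto
  ultimately show ?thesis by blast
qed

text \<open>A left factor enters \<open>hit_append\<close> and \<open>surv_append\<close> only
  through its profile. Hence a prefix may be exchanged for one with the same profile, which is what
  cutting out or repeating a loop amounts to.\<close>

lemma profile_append: "profile u = profile u' \<Longrightarrow> profile (u @ v) = profile (u' @ v)"
  unfolding profile_eq_iff by (auto simp: hit_append surv_append)

lemma alive_cong: "profile u = profile v \<Longrightarrow> alive u = alive v"
  unfolding alive_def initial_def profile_eq_iff by auto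

lemma profile_pigeonhole:
  assumes "profile_bound \<le> length u"
  obtains x y z where "u = x @ y @ z" "y \<noteq> []" "profile (x @ y) = profile x"
proof -
  let ?f = "\<lambda>i. profile (take i u)"
  \<comment> \<open>The second range includes \<open>n\<close>, the mark of a hit, which gives
    \<open>n * (n + 1)\<close> pairs.\<close>
  let ?P = "Pow ({..<n} \<times> {..n})"
  have sub: "?f ` {..profile_bound} \<subseteq> ?P" by (auto simp: profile_def)
  have "card ?P = profile_bound"
    by (simp add: card_Pow profile_bound_def card_cartesian_product)
  then have "card ?P < card {..profile_bound}" by simp
  then have "\<not> inj_on ?f {..profile_bound}"
    using card_inj_on_le[OF _ sub] by (metis finite_Pow_iff finite_SigmaI finite_atMost finite_lessThan not_le)
  then obtain i j where ij: "i < j" "j \<le> profile_bound" "?f i = ?f j"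
    by (metis (mono_tags, lifting) inj_on_def atMost_iff linorder_neqE_nat)
  define y where "y = drop i (take j u)"
  have j: "take j u = take i u @ y"
    using ij by (metis append_take_drop_id min.absorb1 less_imp_le take_take y_def)
  have "u = take i u @ y @ drop j u"
    using j by (metis append.assoc append_take_drop_id)
  moreover have "length y = j - i" using ij assms by (simp add: y_def)
  then have "y \<noteq> []" using ij by auto
  moreover have "profile (take i u @ y) = profile (take i u)"
    using ij(3) j by simp
  ultimately show ?thesis using that by blast
qed

lemma profile_shorten:
  "u \<in> W \<Longrightarrow> \<exists>v\<in>W. length v \<le> profile_bound \<and> profile v = profile u"
proof (induction u rule: length_induct)
  case (1 u)
  show ?case
  proof (cases "length u \<le> profile_bound")
    case False
    then obtain x y z where xyz: "u = x @ y @ z" "y \<noteq> []" "profile (x @ y) = profile x"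
      using profile_pigeonhole[of u] by (metis nat_le_linear)
    have "length (x @ z) < length u" "x @ z \<in> W" using xyz 1 by auto
    then obtain v where "v \<in> W" "length v \<le> profile_bound" "profile v = profile (x @ z)"
      using 1 by blast
    moreover have "profile (x @ z) = profile u"
      using profile_append[OF xyz(3), of z] xyz(1) by simp
    ultimately show ?thesis by auto
  qed (use 1 in auto)
qed

text \<open>A profile records all states together, so one pumped word avoids the target from every
  state of \<open>B\<close> at once. The uses are the set of initial states and a single
  survivor.\<close>

lemma ex_infinite_no_hit:
  assumes u: "u \<in> W" "length u = profile_bound" and B: "B \<subseteq> {..<n}"
    and no_hit: "\<And>q. q \<in> B \<Longrightarrow> \<not> hit q u"
  shows "\<exists>w. sset w \<subseteq> {..<k} \<and> (\<forall>q\<in>B. \<forall>m. \<not> hit q (stake m w))"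
proof -
  obtain x y z where xyz: "u = x @ y @ z" "y \<noteq> []" "profile (x @ y) = profile x"
    using profile_pigeonhole[of u] u by auto
  define w where "w = x @- cycle y"
  have "sset w \<subseteq> {..<k}"
    using u xyz by (auto simp: w_def sset_cycle)
  moreover have "\<not> hit q (stake m w)" if q: "q \<in> B" for q m
  proof
    assume hit: "hit q (stake m w)"
    have qn: "q < n" using q B by auto
    have pow: "profile (x @ concat (replicate j y)) = profile x" for j
    proof (induction j)
      case (Suc j)
      have "profile (x @ concat (replicate (Suc j) y)) = profile ((x @ y) @ concat (replicate j y))"
        by simp
      also have "\<dots> = profile (x @ concat (replicate j y))"
        by (rule profile_append[OF xyz(3)])
      finally show ?case using Suc by simp
    qed simp
    have cyc: "cycle y = concat (replicate j y) @- cycle y" for j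
    proof (induction j)
      case (Suc j)
      have "cycle y = y @- concat (replicate j y) @- cycle y"
        using cycle_decomp[OF xyz(2)] Suc by metis
      then show ?case by simp
    qed simp
    \<comment> \<open>As \<open>y\<close> is nonempty, \<open>m\<close> copies of it reach beyond
      the first \<open>m\<close> letters of the period; a hit within \<open>m\<close> letters of
      \<open>w\<close> is thus a hit along \<open>?v\<close>, whose profile is that of
      \<open>x\<close>.\<close>
    let ?v = "x @ concat (replicate m y)"
    have "w = ?v @- cycle y" unfolding w_def using cyc[of m] by simp
    then have "stake (length ?v) w = ?v" by (simp add: stake_shift)
    moreover have "m \<le> length (concat (replicate m y))"
      using xyz(2) by (induction m) (auto simp: Suc_le_eq neq_Nil_conv)
    then have "m \<le> length ?v" by simp
    ultimately have "hit q ?v" using hit_mono[OF qn hit] by metis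
    then have "hit q x" using pow[of m] qn by (simp add: profile_eq_iff)
    then have "hit q u" by (simp add: xyz(1) hit_append[OF qn])
    with no_hit[OF q] show False by simp
  qed
  ultimately show ?thesis by blast
qed

lemma ex_stream_extends:
  assumes "u \<in> W"
  obtains w where "sset w \<subseteq> {..<k}" "stake (length u) w = u"
proof
  show "sset (u @- sconst 0) \<subseteq> {..<k}" using assms letters by auto
  show "stake (length u) (u @- sconst 0) = u" by (simp add: stake_shift)
qed

section \<open>Criteria by short words for the four problems\<close>

theorem ex_pos_hit_iff:
  "(\<exists>w. sset w \<subseteq> {..<k} \<and> pos_hit w) \<longleftrightarrow>
   (\<exists>u\<in>W. length u \<le> profile_bound \<and> (\<exists>q\<in>initial. hit q u))"
proof
  assume "\<exists>w. sset w \<subseteq> {..<k} \<and> pos_hit w"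
  then obtain w m q where w: "sset w \<subseteq> {..<k}" "q \<in> initial" "hit q (stake m w)"
    using pos_hit_iff by blast
  from profile_shorten[OF stake_W[OF w(1)]] obtain v where
    "v \<in> W" "length v \<le> profile_bound" "profile v = profile (stake m w)" by blast
  with w show "\<exists>u\<in>W. length u \<le> profile_bound \<and> (\<exists>q\<in>initial. hit q u)"
    by (auto simp: profile_eq_iff initial_def)
next
  assume "\<exists>u\<in>W. length u \<le> profile_bound \<and> (\<exists>q\<in>initial. hit q u)"
  then obtain u q where u: "u \<in> W" "q \<in> initial" "hit q u" by blast
  from ex_stream_extends[OF u(1)] obtain w where
    w: "sset w \<subseteq> {..<k}" "stake (length u) w = u" .
  then have "pos_hit w" using u by (subst pos_hit_iff) (auto intro!: exI[of _ "length u"])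
  with w show "\<exists>w. sset w \<subseteq> {..<k} \<and> pos_hit w" by blast
qed

text \<open>The length is exact, not an upper bound: a shorter word without a hit need not contain a
  loop to pump, while every infinite word has a prefix of exactly this length.\<close>

theorem all_pos_hit_iff:
  "(\<forall>w. sset w \<subseteq> {..<k} \<longrightarrow> pos_hit w) \<longleftrightarrow>
   (\<forall>u\<in>W. length u = profile_bound \<longrightarrow> (\<exists>q\<in>initial. hit q u))"
proof
  assume *: "\<forall>w. sset w \<subseteq> {..<k} \<longrightarrow> pos_hit w"
  show "\<forall>u\<in>W. length u = profile_bound \<longrightarrow> (\<exists>q\<in>initial. hit q u)"
  proof (intro ballI impI, rule ccontr)
    fix u assume "u \<in> W" "length u = profile_bound" "\<not> (\<exists>q\<in>initial. hit q u)"
    then obtain w where "sset w \<subseteq> {..<k}" "\<forall>q\<in>initial. \<forall>m. \<not> hit q (stake m w)"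
      using ex_infinite_no_hit[of u initial] by (auto simp: initial_def)
    with * pos_hit_iff show False by blast
  qed
next
  assume *: "\<forall>u\<in>W. length u = profile_bound \<longrightarrow> (\<exists>q\<in>initial. hit q u)"
  show "\<forall>w. sset w \<subseteq> {..<k} \<longrightarrow> pos_hit w"
    using * stake_W pos_hit_iff by (metis length_stake)
qed

theorem all_as_hit_iff:
  "(\<forall>w. sset w \<subseteq> {..<k} \<longrightarrow> as_hit w) \<longleftrightarrow>
   (\<forall>u\<in>W. length u \<le> profile_bound \<longrightarrow>
     (\<forall>q\<in>alive u. \<forall>v\<in>W. length v = profile_bound \<longrightarrow> hit q v))"
proof
  assume *: "\<forall>w. sset w \<subseteq> {..<k} \<longrightarrow> as_hit w"
  show "\<forall>u\<in>W. length u \<le> profile_bound \<longrightarrow>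
     (\<forall>q\<in>alive u. \<forall>v\<in>W. length v = profile_bound \<longrightarrow> hit q v)"
  proof (intro ballI impI, rule ccontr)
    fix u q v assume u: "u \<in> W" "q \<in> alive u" and v: "v \<in> W" "length v = profile_bound" "\<not> hit q v"
    obtain w where w: "sset w \<subseteq> {..<k}" "\<And>m. \<not> hit q (stake m w)"
      using ex_infinite_no_hit[of v "{q}"] u v by (auto simp: alive_def)
    have W: "sset (u @- w) \<subseteq> {..<k}" using u w by auto
    with * have "as_hit (u @- w)" by blast
    from as_hitD[OF W this, of q "length u"] u w(2) show False
      by (auto simp: stake_shift sdrop_shift)
  qed
next
  assume *: "\<forall>u\<in>W. length u \<le> profile_bound \<longrightarrow>
     (\<forall>q\<in>alive u. \<forall>v\<in>W. length v = profile_bound \<longrightarrow> hit q v)"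
  show "\<forall>w. sset w \<subseteq> {..<k} \<longrightarrow> as_hit w"
  \<comment> \<open>Blocks of length \<open>profile_bound\<close> from the start: the survivors at a
    boundary are also the survivors of a short word with the same profile, to which the assumption
    applies.\<close>
  proof (intro allI impI, rule as_hitI[of _ 0 profile_bound])
    fix w i q assume w: "sset w \<subseteq> {..<k}" and q: "q \<in> alive (stake (0 + i * profile_bound) w)"
    from profile_shorten[OF stake_W[OF w]] obtain u where
      u: "u \<in> W" "length u \<le> profile_bound" "profile u = profile (stake (0 + i * profile_bound) w)" by blast
    from q alive_cong[OF u(3)] have "q \<in> alive u" by simp
    then show "hit q (stake profile_bound (sdrop (0 + i * profile_bound) w))"
      using * u w by (meson length_stake sset_sdrop stake_W)
  qed
qed

theorem ex_as_hit_iff: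
  "(\<exists>w. sset w \<subseteq> {..<k} \<and> as_hit w) \<longleftrightarrow>
   (\<exists>u\<in>W. length u \<le> profile_bound \<and> (\<exists>v\<in>W. length v \<le> profile_bound \<and>
     (\<forall>q\<in>alive u. hit q v \<and> (\<forall>p<n. surv q v p \<longrightarrow> p \<in> alive u))))"
proof
  assume "\<exists>w. sset w \<subseteq> {..<k} \<and> as_hit w"
  then obtain w where w: "sset w \<subseteq> {..<k}" "as_hit w" by blast
  have fin: "finite (alive u)" for u by (simp add: alive_def)
  \<comment> \<open>There are finitely many survivors, and a hit persists when the prefix is
    prolonged, so one block length serves them all.\<close>
  have "\<exists>j. \<forall>q\<in>alive (stake i w). hit q (stake j (sdrop i w))" for i
  proof -
    have "\<forall>q\<in>alive (stake i w). \<exists>j. hit q (stake j (sdrop i w))"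
      using as_hitD[OF w] by blast
    then obtain f where f: "\<And>q. q \<in> alive (stake i w) \<Longrightarrow> hit q (stake (f q) (sdrop i w))"
      by metis
    have "hit q (stake (Max (f ` alive (stake i w))) (sdrop i w))" if "q \<in> alive (stake i w)" for q
    proof (rule hit_mono[OF _ f[OF that]])
      show "q < n" using that by (simp add: alive_def)
      show "f q \<le> Max (f ` alive (stake i w))" using fin that by (intro Max_ge) auto
    qed
    then show ?thesis by blast
  qed
  then obtain J where J: "\<And>i q. q \<in> alive (stake i w) \<Longrightarrow> hit q (stake (J i) (sdrop i w))"
    by metis
  \<comment> \<open>\<open>t\<close> lists block boundaries such that each block offers a hit to
    every state alive at its start.\<close>
  define t where "t = rec_nat 0 (\<lambda>_ i. i + J i)"
  have t_Suc: "t (Suc i) = t i + J (t i)" for i by (simp add: t_def)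
  have t_mono: "t i \<le> t j" if "i \<le> j" for i j
    using that by (induction rule: dec_induct) (auto simp: t_Suc)
  \<comment> \<open>The sets of survivors at the boundaries lie in a finite power set, so two of
    them coincide; the segment between these boundaries becomes the period of the lasso.\<close>
  have "\<not> inj (\<lambda>i. alive (stake (t i) w))"
  proof
    assume "inj (\<lambda>i. alive (stake (t i) w))"
    then have "infinite (range (\<lambda>i. alive (stake (t i) w)))"
      by (rule range_inj_infinite)
    moreover have "range (\<lambda>i. alive (stake (t i) w)) \<subseteq> Pow {..<n}"
      by (auto simp: alive_def)
    ultimately show False by (meson finite_Pow_iff finite_lessThan finite_subset)
  qed
  then obtain a b where ab: "a < b" "alive (stake (t a) w) = alive (stake (t b) w)"
    by (metis (mono_tags, lifting) injI linorder_neqE_nat)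
  define u where "u = stake (t a) w"
  define v where "v = stake (t b - t a) (sdrop (t a) w)"
  have uW: "u \<in> W" and vW: "v \<in> W"
    unfolding u_def v_def by (intro stake_W sset_sdrop w)+
  have "u @ v = stake (t b) w"
    unfolding u_def v_def stake_add using t_mono[of a b] ab by simp
  then have alive_uv: "alive (u @ v) = alive u" using ab by (simp add: u_def)
  have hit_v: "hit q v" if q: "q \<in> alive u" for q
  proof -
    \<comment> \<open>As \<open>a < b\<close>, the period contains the whole block that starts at
      \<open>t a\<close>.\<close>
    have "J (t a) \<le> t b - t a" using t_mono[of "Suc a" b] ab by (simp add: t_Suc)
    then show ?thesis
      using J[of q "t a"] q unfolding u_def v_def by (auto simp: alive_def intro: hit_mono)
  qed
  from profile_shorten[OF uW] obtain u' where
    u': "u' \<in> W" "length u' \<le> profile_bound" "profile u' = profile u" by blast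
  from profile_shorten[OF vW] obtain v' where
    v': "v' \<in> W" "length v' \<le> profile_bound" "profile v' = profile v" by blast
  have "hit q v' \<and> (\<forall>p<n. surv q v' p \<longrightarrow> p \<in> alive u')" if "q \<in> alive u'" for q
  proof -
    have q: "q \<in> alive u" "q < n" using that alive_cong[OF u'(3)] by (auto simp: alive_def)
    then have "hit q v'" using hit_v v'(3) by (simp add: profile_eq_iff)
    moreover have "p \<in> alive u'" if "p < n" "surv q v' p" for p
      using q that v'(3) alive_cong[OF u'(3)] alive_uv by (auto simp: alive_append profile_eq_iff)
    ultimately show ?thesis by blast
  qed
  with u' v' show "\<exists>u\<in>W. length u \<le> profile_bound \<and> (\<exists>v\<in>W. length v \<le> profile_bound \<and>
     (\<forall>q\<in>alive u. hit q v \<and> (\<forall>p<n. surv q v p \<longrightarrow> p \<in> alive u)))" by blast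
next
  assume "\<exists>u\<in>W. length u \<le> profile_bound \<and> (\<exists>v\<in>W. length v \<le> profile_bound \<and>
     (\<forall>q\<in>alive u. hit q v \<and> (\<forall>p<n. surv q v p \<longrightarrow> p \<in> alive u)))"
  then obtain u v0 where u: "u \<in> W" and v0: "v0 \<in> W"
    "\<forall>q\<in>alive u. hit q v0 \<and> (\<forall>p<n. surv q v0 p \<longrightarrow> p \<in> alive u)" by blast
  \<comment> \<open>\<open>cycle\<close> needs a nonempty period. An empty \<open>v0\<close> hits
    from no state, so in that case there are no survivors and any letter will do.\<close>
  obtain v where v: "v \<in> W" "v \<noteq> []"
    "\<And>q. q \<in> alive u \<Longrightarrow> hit q v" "\<And>q p. q \<in> alive u \<Longrightarrow> p < n \<Longrightarrow> surv q v p \<Longrightarrow> p \<in> alive u"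
  proof (cases "v0 = []")
    case True
    with v0 have "alive u = {}" by auto
    then show ?thesis using that[of "[0]"] letters by auto
  next
    case False
    then show ?thesis using that[of v0] v0 by blast
  qed
  define w where "w = u @- cycle v"
  have w: "sset w \<subseteq> {..<k}" using u v by (auto simp: w_def sset_cycle)
  have drop: "sdrop (length u + i * length v) w = cycle v" for i
  proof -
    have "sdrop (i * length v) (cycle v) = cycle v"
    proof (induction i)
      case (Suc i)
      have "sdrop (length v) (cycle v) = cycle v"
        by (metis cycle_decomp[OF v(2)] sdrop_shift diff_self_eq_0 drop_all order_refl sdrop.simps(1) shift.simps(1))
      with Suc show ?case by (simp flip: sdrop_add)
    qed simp
    then show ?thesis by (simp add: w_def sdrop_shift flip: sdrop_add)
  qed
  have take: "stake (length v) (cycle v) = v"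
    using v(2) by (simp add: stake_cycle_eq)
  \<comment> \<open>Inclusion is the right invariant: the set of survivors may shrink from period to
    period.\<close>
  have alive: "alive (stake (length u + i * length v) w) \<subseteq> alive u" for i
  proof (induction i)
    case (Suc i)
    have "stake (length u + Suc i * length v) w = stake (length u + i * length v) w @ v"
      using drop[of i] take stake_add[of "length u + i * length v" w "length v"] by (simp add: algebra_simps)
    with Suc v(4) show ?case by (auto simp: alive_append)
  qed (simp add: w_def stake_shift)
  have "as_hit w"
  proof (rule as_hitI[OF w])
    fix i q assume "q \<in> alive (stake (length u + i * length v) w)"
    with alive v(3) show "hit q (stake (length v) (sdrop (length u + i * length v) w))"
      by (auto simp: drop take)
  qed
  with w show "\<exists>w. sset w \<subseteq> {..<k} \<and> as_hit w" by blast
qed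

end

section \<open>The measure on runs\<close>

lemma sum_init_p: "valid_pwa A \<Longrightarrow> (\<Sum>q<nq A. init_p A q) = 1"
proof -
  assume "valid_pwa A"
  then have "(\<Sum>q<nq A. init A ! q) = 1" by (simp add: valid_pwa_def)
  then have "real_of_rat (\<Sum>q<nq A. init A ! q) = 1" by simp
  then show ?thesis by (simp add: init_p_def of_rat_sum)
qed

lemma sum_trans_p: "valid_pwa A \<Longrightarrow> q < nq A \<Longrightarrow> a < ns A \<Longrightarrow> (\<Sum>q'<nq A. trans_p A q a q') = 1"
proof -
  assume *: "valid_pwa A" "q < nq A" "a < ns A"
  then have "(\<Sum>q'<nq A. trans A ! q ! a ! q') = 1" by (simp add: valid_pwa_def)
  then have "real_of_rat (\<Sum>q'<nq A. trans A ! q ! a ! q') = 1" by simp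
  then show ?thesis using * by (simp add: trans_p_def of_rat_sum)
qed

lemma init_p_nonneg: "valid_pwa A \<Longrightarrow> 0 \<le> init_p A q"
  by (simp add: init_p_def valid_pwa_def)

lemma trans_p_nonneg: "valid_pwa A \<Longrightarrow> 0 \<le> trans_p A q a q'"
  by (simp add: trans_p_def valid_pwa_def)

lemma target_automaton_pwa: "valid_pwa A \<Longrightarrow> target_automaton (nq A) (ns A) (init_p A) (trans_p A)"
  by unfold_locales
     (auto simp: sum_init_p sum_trans_p init_p_nonneg trans_p_nonneg, simp add: valid_pwa_def)

lemma pmf_embed_pmf_finite:
  assumes "\<And>x. 0 \<le> f x" "\<And>x. n \<le> x \<Longrightarrow> f x = 0" "(\<Sum>x<n. f x) = 1"
  shows "pmf (embed_pmf f) (x::nat) = f x"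
proof (rule pmf_embed_pmf)
  have "(\<integral>\<^sup>+x. ennreal (f x) \<partial>count_space UNIV) = (\<Sum>x<n. ennreal (f x))"
    by (rule nn_integral_count_space') (auto simp: assms(2))
  also have "\<dots> = ennreal (\<Sum>x<n. f x)"
    using assms(1) by (intro sum_ennreal) auto
  finally show "(\<integral>\<^sup>+x. ennreal (f x) \<partial>count_space UNIV) = 1"
    by (simp add: assms(3))
qed (rule assms(1))

section \<open>Existence and uniqueness of the run measure\<close>

locale pwa_word =
  fixes A :: pwa and w :: "nat stream"
  assumes valid: "valid_pwa A" and word: "w \<in> words A"
begin

lemma letter: "w !! i < ns A"
  using word by (fastforce simp: words_def sset_range)

definition step_prob :: "nat \<Rightarrow> nat \<Rightarrow> nat \<Rightarrow> real" where
  "step_prob i p q = (if i = 0 then init_p A q else trans_p A p (w !! (i - 1)) q)"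

text \<open>\<open>trans_p\<close> vanishes on rows outside the automaton, so these define no
  distribution; the point mass at 0 is a default there. Step 0 draws from the initial distribution
  whatever \<open>p\<close> is.\<close>

definition kernel :: "nat \<times> nat \<Rightarrow> nat pmf" where
  "kernel = (\<lambda>(i, p). if i = 0 \<or> p < nq A then embed_pmf (step_prob i p) else return_pmf 0)"

lemma step_prob_out: "nq A \<le> q \<Longrightarrow> step_prob i p q = 0"
  by (simp add: step_prob_def init_p_def trans_p_def)

lemma step_prob_nonneg: "0 \<le> step_prob i p q"
  by (simp add: step_prob_def init_p_nonneg trans_p_nonneg valid)

lemma pmf_kernel:
  assumes "i = 0 \<or> p < nq A"
  shows "pmf (kernel (i, p)) q = step_prob i p q"
proof -
  have "(\<Sum>q<nq A. step_prob i p q) = 1"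
    using assms by (cases "i = 0") (auto simp: step_prob_def sum_init_p sum_trans_p valid letter)
  then have "pmf (embed_pmf (step_prob i p)) q = step_prob i p q"
    by (intro pmf_embed_pmf_finite) (auto simp: step_prob_nonneg step_prob_out)
  with assms show ?thesis by (simp add: kernel_def)
qed

text \<open>All coordinates \<open>X (i, p)\<close> are independent; \<open>X (i, p)\<close> is the state entered in
  step \<open>i\<close> when the previous state is \<open>p\<close>.\<close>

primrec run_of :: "(nat \<times> nat \<Rightarrow> nat) \<Rightarrow> nat \<Rightarrow> nat" where
  "run_of X 0 = X (0, 0)"
| "run_of X (Suc i) = X (Suc i, run_of X i)"

definition prev :: "nat list \<Rightarrow> nat \<Rightarrow> nat" where
  "prev qs i = (if i = 0 then 0 else qs ! (i - 1))"

lemma prefix_prob_eq: "qs \<noteq> [] \<Longrightarrow> prefix_prob A w qs = (\<Prod>i<length qs. step_prob i (prev qs i) (qs ! i))"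
proof -
  assume "qs \<noteq> []"
  then have "{..<length qs} = insert 0 {1..<length qs}" by auto
  then show ?thesis
    by (simp add: prefix_prob_def step_prob_def prev_def)
qed

text \<open>The default rows of \<open>kernel\<close> differ from \<open>trans_p\<close>, but a
  prefix meets them only after leaving the state range, and the factor at its first exit is 0 in
  both products.\<close>

lemma prefix_prob_kernel:
  assumes "qs \<noteq> []"
  shows "prefix_prob A w qs = (\<Prod>i<length qs. pmf (kernel (i, prev qs i)) (qs ! i))"
proof (cases "\<forall>i<length qs. qs ! i < nq A")
  case True
  then show ?thesis
    unfolding prefix_prob_eq[OF assms]
    by (intro prod.cong) (auto simp: pmf_kernel prev_def)
next
  case False
  \<comment> \<open>At the first exit the previous state is still in range, or there is none, so
    \<open>kernel\<close> agrees with \<open>step_prob\<close> there.\<close>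
  define i where "i = (LEAST i. i < length qs \<and> \<not> qs ! i < nq A)"
  have i: "i < length qs" "\<not> qs ! i < nq A"
    using LeastI_ex[of "\<lambda>i. i < length qs \<and> \<not> qs ! i < nq A"] False by (auto simp: i_def)
  have "i = 0 \<or> prev qs i < nq A"
    using not_less_Least[of "i - 1" "\<lambda>i. i < length qs \<and> \<not> qs ! i < nq A"] i
    by (auto simp: prev_def i_def[symmetric])
  then have "pmf (kernel (i, prev qs i)) (qs ! i) = 0" "step_prob i (prev qs i) (qs ! i) = 0"
    using i by (auto simp: pmf_kernel step_prob_out)
  with i(1) show ?thesis
    unfolding prefix_prob_eq[OF assms] by (auto intro!: prod_zero trans[OF prod_zero sym[OF prod_zero]])
qed

lemma stake_eq_iff: "stake (length qs) r = qs \<longleftrightarrow> (\<forall>i<length qs. r !! i = qs ! i)"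
  by (auto simp: list_eq_iff_nth_eq)

lemma space_run [simp]: "space (stream_space (count_space (UNIV :: nat set))) = UNIV"
  by (simp add: space_stream_space)

text \<open>The measure is the image under \<open>run_of\<close> of the product of all kernels. A
  cylinder fixes one coordinate per step, and these coordinates are distinct because each carries
  its step number, so independence gives the product formula.\<close>

lemma ex_run_measure:
  "\<exists>M. prob_space M \<and> sets M = sets (stream_space (count_space UNIV)) \<and>
      (\<forall>qs. qs \<noteq> [] \<longrightarrow>
         emeasure M {r \<in> space M. stake (length qs) r = qs} = ennreal (prefix_prob A w qs))"
proof -
  let ?K = "\<lambda>x. measure_pmf (kernel x)"
  interpret P: product_prob_space ?K UNIV
    by unfold_locales
  let ?P = "PiM UNIV ?K" and ?S = "stream_space (count_space UNIV) :: nat stream measure"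
  have comp: "(\<lambda>X. X x) \<in> ?P \<rightarrow>\<^sub>M count_space UNIV" for x
    using measurable_component_singleton[of x UNIV ?K] by simp
  have run: "(\<lambda>X. run_of X i) \<in> ?P \<rightarrow>\<^sub>M count_space UNIV" for i
  proof (induction i)
    case (Suc i)
    show ?case
      unfolding run_of.simps by (rule measurable_compose_countable[OF comp Suc])
  qed (simp add: comp)
  let ?f = "\<lambda>X. to_stream (run_of X)"
  have snth: "to_stream X !! i = X i" for X :: "nat \<Rightarrow> nat" and i
    by (simp add: to_stream_def)
  have f: "?f \<in> ?P \<rightarrow>\<^sub>M ?S"
    by (rule measurable_stream_space2) (simp add: snth run)
  let ?M = "distr ?P ?S ?f"
  have "emeasure ?M {r \<in> space ?M. stake (length qs) r = qs} = ennreal (prefix_prob A w qs)"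
    if qs: "qs \<noteq> []" for qs
  proof -
    let ?J = "(\<lambda>i. (i, prev qs i)) ` {..<length qs}"
    have inj: "inj_on (\<lambda>i. (i, prev qs i)) {..<length qs}" by (auto intro: inj_onI)
    \<comment> \<open>Once the earlier states agree with \<open>qs\<close>, the coordinate read at
      step \<open>m\<close> is \<open>(m, prev qs m)\<close>; a cylinder of runs thus becomes a
      condition on coordinates fixed in advance.\<close>
    have run_eq: "(\<forall>i<m. run_of X i = qs ! i) \<longleftrightarrow> (\<forall>i<m. X (i, prev qs i) = qs ! i)" for X m
    proof (induction m)
      case (Suc m)
      have "run_of X m = X (m, prev qs m)" if "\<forall>i<m. run_of X i = qs ! i"
        using that by (cases m) (auto simp: prev_def)
      with Suc show ?case by (auto simp: less_Suc_eq)
    qed simp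
    have "{r \<in> space ?S. stake (length qs) r = qs} \<in> sets ?S" by measurable
    then have "emeasure ?M {r \<in> space ?M. stake (length qs) r = qs} =
        emeasure ?P (?f -` {r \<in> space ?S. stake (length qs) r = qs} \<inter> space ?P)"
      by (simp add: emeasure_distr[OF f])
    also have "?f -` {r \<in> space ?S. stake (length qs) r = qs} \<inter> space ?P =
        {X \<in> space ?P. \<forall>x\<in>?J. X x \<in> {qs ! fst x}}"
      using run_eq[of "length qs"] by (auto simp: stake_eq_iff snth)
    also have "emeasure ?P \<dots> = (\<Prod>x\<in>?J. emeasure (?K x) {qs ! fst x})"
      by (rule P.emeasure_PiM_Collect) auto
    also have "\<dots> = (\<Prod>i<length qs. ennreal (pmf (kernel (i, prev qs i)) (qs ! i)))"
      by (subst prod.reindex[OF inj]) (simp add: emeasure_pmf_single)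
    also have "\<dots> = ennreal (prefix_prob A w qs)"
      unfolding prefix_prob_kernel[OF qs] by (rule prod_ennreal) auto
    finally show ?thesis .
  qed
  moreover have "prob_space ?M" by (rule P.prob_space_distr[OF f])
  ultimately show ?thesis by (intro exI[of _ ?M]) auto
qed

lemma sstart_UNIV: "sstart UNIV qs = {r. stake (length qs) r = qs}"
proof -
  have "r \<in> sstart UNIV qs \<longleftrightarrow> stake (length qs) r = qs" for r
    by (induction qs arbitrary: r) (auto simp: streams_UNIV)
  then show ?thesis by blast
qed

abbreviation M :: "nat stream measure" where
  "M \<equiv> run_measure A w"

text \<open>Justifies the definite description: existence is \<open>ex_run_measure\<close>, and
  uniqueness holds because a probability measure on streams is determined by its values on
  cylinders.\<close>

lemma run_measure_props:
  "prob_space M \<and> sets M = sets (stream_space (count_space UNIV)) \<and>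
      (\<forall>qs. qs \<noteq> [] \<longrightarrow>
         emeasure M {r \<in> space M. stake (length qs) r = qs} = ennreal (prefix_prob A w qs))"
  unfolding run_measure_def
proof (rule theI')
  let ?Q = "\<lambda>M. prob_space M \<and> sets M = sets (stream_space (count_space (UNIV :: nat set))) \<and>
      (\<forall>qs. qs \<noteq> [] \<longrightarrow>
         emeasure M {r \<in> space M. stake (length qs) r = qs} = ennreal (prefix_prob A w qs))"
  obtain N where N: "?Q N" using ex_run_measure by blast
  have "N' = N" if N': "?Q N'" for N'
  proof (rule stream_space_eq_sstart[of UNIV])
    have "space N' = UNIV" "space N = UNIV"
      using N N' sets_eq_imp_space_eq[of _ "stream_space (count_space (UNIV :: nat set))"] by auto
    then show "emeasure N' (sstart UNIV xs) = emeasure N (sstart UNIV xs)" if "xs \<noteq> []" for xs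
      using N N' that by (simp add: sstart_UNIV)
  qed (use N N' in \<open>auto simp: streams_UNIV\<close>)
  with N show "\<exists>!M. ?Q M" by (rule ex1I)
qed

sublocale M: prob_space M
  using run_measure_props by blast

lemma sets_M [measurable_cong]: "sets M = sets (stream_space (count_space UNIV))"
  using run_measure_props by blast

lemma space_M [simp]: "space M = UNIV"
  using sets_eq_imp_space_eq[OF sets_M] by simp

lemma prefix_prob_nonneg: "qs \<noteq> [] \<Longrightarrow> 0 \<le> prefix_prob A w qs"
  by (simp add: prefix_prob_eq prod_nonneg step_prob_nonneg)

lemma measure_prefix: "qs \<noteq> [] \<Longrightarrow> measure M {r. stake (length qs) r = qs} = prefix_prob A w qs"
  using run_measure_props prefix_prob_nonneg[of qs] by (auto simp: measure_def)

lemma prefix_prob_out: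
  assumes "qs \<noteq> []" "nq A \<le> last qs"
  shows "prefix_prob A w qs = 0"
proof -
  have "step_prob (length qs - 1) (prev qs (length qs - 1)) (qs ! (length qs - 1)) = 0"
    using assms by (intro step_prob_out) (simp add: last_conv_nth)
  with assms(1) show ?thesis
    unfolding prefix_prob_eq[OF assms(1)] by (intro prod_zero) auto
qed

lemma prefix_prob_snoc:
  assumes "qs \<noteq> []"
  shows "prefix_prob A w (qs @ [q]) = prefix_prob A w qs * trans_p A (last qs) (w !! (length qs - 1)) q"
proof -
  have "{1..<length (qs @ [q])} = insert (length qs) {1..<length qs}" using assms by (auto simp: Suc_le_eq)
  moreover have "(\<Prod>i\<in>{1..<length qs}. trans_p A ((qs @ [q]) ! (i - 1)) (w !! (i - 1)) ((qs @ [q]) ! i)) =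
      (\<Prod>i\<in>{1..<length qs}. trans_p A (qs ! (i - 1)) (w !! (i - 1)) (qs ! i))"
    by (intro prod.cong) (auto simp: nth_append)
  ultimately show ?thesis
    using assms by (simp add: prefix_prob_def nth_append last_conv_nth mult.commute mult.left_commute)
qed

text \<open>The space consists of all streams of numbers; those out of range at position
  \<open>i\<close> are covered by countably many null cylinders.\<close>

lemma AE_in_range: "AE r in M. r !! i < nq A"
proof -
  have "{r. \<not> r !! i < nq A} \<subseteq> (\<Union>qs\<in>{qs. length qs = Suc i \<and> nq A \<le> last qs}. {r. stake (length qs) r = qs})"
  proof safe
    fix r :: "nat stream" assume "\<not> r !! i < nq A"
    moreover have "last (stake (Suc i) r) = r !! i"
      by (simp add: stake_Suc del: stake.simps)
    ultimately show "r \<in> (\<Union>qs\<in>{qs. length qs = Suc i \<and> nq A \<le> last qs}. {r. stake (length qs) r = qs})"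
      by (intro UN_I[of "stake (Suc i) r"]) auto
  qed
  moreover have "(\<Union>qs\<in>{qs. length qs = Suc i \<and> nq A \<le> last qs}. {r. stake (length qs) r = qs}) \<in> null_sets M"
  proof (intro null_sets_UN' countableI_type)
    fix qs assume "qs \<in> {qs. length qs = Suc i \<and> nq A \<le> last qs}"
    then have qs: "qs \<noteq> []" "nq A \<le> last qs" by auto
    have "{r \<in> space M. stake (length qs) r = qs} \<in> sets M" by measurable
    then show "{r. stake (length qs) r = qs} \<in> null_sets M"
      using measure_prefix[OF qs(1)] prefix_prob_out[OF qs] by (simp add: null_setsI M.emeasure_eq_measure)
  qed
  ultimately show ?thesis by (intro AE_I'[rotated]) auto
qed

end

section \<open>The probability of avoiding the target\<close>

locale pwa_word_target = pwa_word +
  fixes T :: "nat \<Rightarrow> nat \<Rightarrow> nat \<Rightarrow> bool"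
begin

sublocale target_automaton "nq A" "ns A" "init_p A" "trans_p A" T
  by (rule target_automaton_pwa[OF valid])

text \<open>The prefix is a parameter so that an induction on \<open>m\<close> can move steps into
  it. The first watched edge leaves the last state of \<open>qs\<close>, whence the index
  \<open>length qs - 1\<close>.\<close>

definition avoid_event :: "nat list \<Rightarrow> nat \<Rightarrow> nat stream set" where
  "avoid_event qs m = {r. stake (length qs) r = qs \<and>
     (\<forall>i<m. \<not> T (r !! (length qs - 1 + i)) (w !! (length qs - 1 + i)) (r !! (length qs + i)))}"

lemma avoid_event_sets [measurable]: "avoid_event qs m \<in> sets M"
proof -
  have "{r \<in> space M. stake (length qs) r = qs \<and>
     (\<forall>i<m. \<not> T (r !! (length qs - 1 + i)) (w !! (length qs - 1 + i)) (r !! (length qs + i)))} \<in> sets M"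
    by measurable
  then show ?thesis by (simp add: avoid_event_def)
qed

lemma avoid_event_Suc:
  assumes "qs \<noteq> []"
  shows "r \<in> avoid_event qs (Suc m) \<longleftrightarrow>
    r \<in> avoid_event (qs @ [r !! length qs]) m \<and> \<not> T (last qs) (w !! (length qs - 1)) (r !! length qs)"
proof -
  have "r !! (length qs - 1) = last qs" if "stake (length qs) r = qs"
    using that assms by (metis diff_less last_conv_nth length_greater_0_conv stake_nth zero_less_one)
  moreover have "stake (Suc (length qs)) r = qs @ [r !! length qs] \<longleftrightarrow> stake (length qs) r = qs"
    by (simp add: stake_Suc del: stake.simps)
  moreover obtain l where "length qs = Suc l"
    using assms by (cases qs) auto
  ultimately show ?thesis
    using assms by (auto simp: avoid_event_def All_less_Suc2 simp del: stake.simps)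
qed

text \<open>Splitting the event by the next state and appending that state to the prefix reproduces
  the recursion of \<open>avoid_prob\<close>.\<close>

lemma measure_avoid_event:
  "qs \<noteq> [] \<Longrightarrow> measure M (avoid_event qs m) =
     prefix_prob A w qs * avoid_prob (last qs) (stake m (sdrop (length qs - 1) w))"
proof (induction m arbitrary: qs)
  case 0
  then show ?case using measure_prefix by (simp add: avoid_event_def)
next
  case (Suc m)
  let ?a = "w !! (length qs - 1)"
  let ?Q = "{q. q < nq A \<and> \<not> T (last qs) ?a q}"
  let ?E = "\<lambda>q. avoid_event (qs @ [q]) m"
  let ?u = "stake m (sdrop (length qs) w)"
  have "measure M (avoid_event qs (Suc m)) = measure M (\<Union>q\<in>?Q. ?E q)"
  proof (rule M.finite_measure_eq_AE)
    \<comment> \<open>The two events agree only almost everywhere, since the union ranges over the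
      states below \<open>nq A\<close>.\<close>
    show "AE r in M. r \<in> avoid_event qs (Suc m) \<longleftrightarrow> r \<in> (\<Union>q\<in>?Q. ?E q)"
      using AE_in_range[of "length qs"]
    proof eventually_elim
      case (elim r)
      have "r !! length qs = q" if "r \<in> ?E q" for q
        using that by (auto simp: avoid_event_def stake_Suc simp del: stake.simps)
      with elim show ?case unfolding avoid_event_Suc[OF Suc.prems] by auto
    qed
  qed auto
  also have "\<dots> = (\<Sum>q\<in>?Q. measure M (?E q))"
  proof (intro M.finite_measure_finite_Union)
    show "disjoint_family_on ?E ?Q"
      by (auto simp: disjoint_family_on_def avoid_event_def stake_Suc simp del: stake.simps)
  qed auto
  also have "\<dots> = (\<Sum>q\<in>?Q. prefix_prob A w qs * trans_p A (last qs) ?a q * avoid_prob q ?u)"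
    using Suc.prems by (intro sum.cong) (auto simp: Suc.IH prefix_prob_snoc)
  also have "\<dots> = (\<Sum>q<nq A. prefix_prob A w qs *
      (trans_p A (last qs) ?a q * of_bool (\<not> T (last qs) ?a q) * avoid_prob q ?u))"
    by (intro sum.mono_neutral_cong_left) auto
  also have "\<dots> = prefix_prob A w qs * avoid_prob (last qs) (?a # ?u)"
    by (simp add: sum_distrib_left)
  also have "?a # ?u = stake (Suc m) (sdrop (length qs - 1) w)"
    using Suc.prems by (simp add: sdrop_simps(1) flip: sdrop_simps(2)) (metis Suc_pred length_greater_0_conv sdrop_simps(2) sdrop.simps(2) sdrop_stl)
  finally show ?case .
qed

lemma measure_avoid_upto:
  "measure M {r. \<forall>i<m. \<not> T (r !! i) (w !! i) (r !! Suc i)} = avoid (stake m w)"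
proof -
  have "measure M {r. \<forall>i<m. \<not> T (r !! i) (w !! i) (r !! Suc i)} = measure M (\<Union>q\<in>{..<nq A}. avoid_event [q] m)"
  proof (rule M.finite_measure_eq_AE)
    show "AE r in M. r \<in> {r. \<forall>i<m. \<not> T (r !! i) (w !! i) (r !! Suc i)} \<longleftrightarrow> r \<in> (\<Union>q\<in>{..<nq A}. avoid_event [q] m)"
      using AE_in_range[of 0] by eventually_elim (auto simp: avoid_event_def)
    have "{r \<in> space M. \<forall>i<m. \<not> T (r !! i) (w !! i) (r !! Suc i)} \<in> sets M" by measurable
    then show "{r. \<forall>i<m. \<not> T (r !! i) (w !! i) (r !! Suc i)} \<in> sets M" by simp
  qed auto
  also have "\<dots> = (\<Sum>q<nq A. measure M (avoid_event [q] m))"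
  proof (intro M.finite_measure_finite_Union)
    show "disjoint_family_on (\<lambda>q. avoid_event [q] m) {..<nq A}"
      by (auto simp: disjoint_family_on_def avoid_event_def)
  qed auto
  also have "\<dots> = avoid (stake m w)"
    by (simp add: measure_avoid_event avoid_def prefix_prob_def)
  finally show ?thesis .
qed

definition hit_event :: "nat stream set" where
  "hit_event = {r. \<exists>i. T (r !! i) (w !! i) (r !! Suc i)}"

lemma hit_event_sets: "hit_event \<in> sets M"
proof -
  have "{r \<in> space M. \<exists>i. T (r !! i) (w !! i) (r !! Suc i)} \<in> sets M" by measurable
  then show ?thesis by (simp add: hit_event_def)
qed

text \<open>Continuity of the measure from above: the complement of \<open>hit_event\<close> is the
  decreasing intersection of the events of avoiding for \<open>m\<close> steps.\<close>

lemma avoid_tendsto: "(\<lambda>m. avoid (stake m w)) \<longlonglongrightarrow> 1 - measure M hit_event"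
proof -
  let ?B = "\<lambda>m. {r. \<forall>i<m. \<not> T (r !! i) (w !! i) (r !! Suc i)}"
  have "{r \<in> space M. \<forall>i<m. \<not> T (r !! i) (w !! i) (r !! Suc i)} \<in> sets M" for m by measurable
  then have "(\<lambda>m. measure M (?B m)) \<longlonglongrightarrow> measure M (\<Inter>m. ?B m)"
    by (intro M.finite_Lim_measure_decseq) (auto simp: decseq_def)
  also have "(\<Inter>m. ?B m) = space M - hit_event" by (auto simp: hit_event_def)
  also have "measure M \<dots> = 1 - measure M hit_event"
    by (rule M.prob_compl[OF hit_event_sets])
  finally show ?thesis unfolding measure_avoid_upto .
qed

lemma sset_word: "sset w \<subseteq> {..<ns A}"
  using word by (auto simp: words_def)

lemma measure_hit_event_eq_1: "measure M hit_event = 1 \<longleftrightarrow> as_hit w"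
proof -
  have "as_hit w \<longleftrightarrow> 1 - measure M hit_event = 0"
    unfolding as_hit_def using avoid_tendsto LIMSEQ_unique by metis
  then show ?thesis by simp
qed

lemma measure_hit_event_pos: "0 < measure M hit_event \<longleftrightarrow> pos_hit w"
proof
  assume "0 < measure M hit_event"
  show "pos_hit w"
  proof (rule ccontr)
    assume "\<not> pos_hit w"
    then have "1 \<le> avoid (stake m w)" for m by (auto simp: pos_hit_def not_less)
    then have "1 \<le> 1 - measure M hit_event"
      by (intro LIMSEQ_le_const[OF avoid_tendsto]) auto
    with \<open>0 < measure M hit_event\<close> show False by simp
  qed
next
  assume "pos_hit w"
  then obtain m where "avoid (stake m w) < 1" by (auto simp: pos_hit_def)
  moreover have "1 - measure M hit_event \<le> avoid (stake m w)"
    by (rule LIMSEQ_le_const2[OF avoid_tendsto])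
       (use avoid_antimono[OF sset_word] in blast)
  ultimately show "0 < measure M hit_event" by simp
qed

end

text \<open>If \<open>P \<nu>\<close> fails, \<open>between\<close> places every admissible
  threshold under a value of \<open>f\<close> below \<open>\<nu>\<close>; there are finitely many
  such values, and their maximum keeps the supremum strictly below \<open>\<nu>\<close>. The
  premises \<open>low\<close> and \<open>ex\<close> make the set nonempty and bounded, so that
  \<open>Sup\<close> on the reals is a genuine supremum.\<close>

lemma Sup_ge_iff_finite_range:
  fixes f :: "'a \<Rightarrow> real"
  assumes fin: "finite (range f)"
    and low: "\<And>\<eta>. (\<And>r. \<eta> \<le> f r) \<Longrightarrow> P \<eta>"
    and ex: "\<And>\<eta>. P \<eta> \<Longrightarrow> \<exists>r. \<eta> \<le> f r"
    and between: "\<And>\<eta>. P \<eta> \<Longrightarrow> \<not> P \<nu> \<Longrightarrow> \<exists>r. \<eta> \<le> f r \<and> f r < \<nu>"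
  shows "\<nu> \<le> Sup {\<eta>. P \<eta>} \<longleftrightarrow> P \<nu>"
proof
  assume "P \<nu>"
  moreover have "bdd_above {\<eta>. P \<eta>}"
    using ex fin by (intro bdd_aboveI[of _ "Max (range f)"]) (auto dest!: ex intro: order_trans)
  ultimately show "\<nu> \<le> Sup {\<eta>. P \<eta>}" by (intro cSup_upper) auto
next
  assume ge: "\<nu> \<le> Sup {\<eta>. P \<eta>}"
  show "P \<nu>"
  proof (rule ccontr)
    assume not: "\<not> P \<nu>"
    let ?V = "{v \<in> range f. v < \<nu>}"
    have P_min: "P (Min (range f))" using fin by (intro low) auto
    from between[OF this not] have ne: "?V \<noteq> {}" by auto
    have "\<eta> \<le> Max ?V" if "P \<eta>" for \<eta>
    proof -
      from between[OF that not] obtain r where r: "\<eta> \<le> f r" "f r < \<nu>" by blast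
      then have "f r \<le> Max ?V" using fin by (intro Max_ge) auto
      with r show ?thesis by simp
    qed
    then have "Sup {\<eta>. P \<eta>} \<le> Max ?V" using P_min by (intro cSup_least) auto
    also have "Max ?V < \<nu>" using Max_in[OF _ ne] fin by auto
    finally show False using ge by simp
  qed
qed

section \<open>The two semantics at a threshold\<close>

context pwa_word
begin

lemma finite_weights: "finite (range (\<lambda>r. sup_weight A w r))"
  and sup_weight_ge_iff: "\<eta> \<le> sup_weight A w r \<longleftrightarrow> (\<exists>i. \<eta> \<le> wt_v A (r !! i) (w !! i) (r !! Suc i))"
proof -
  \<comment> \<open>0 is the value of \<open>wt_v\<close> outside the ranges, which arbitrary
    streams may reach.\<close>
  let ?V = "insert 0 ((\<lambda>(q, a, q'). wt_v A q a q') ` ({..<nq A} \<times> {..<ns A} \<times> {..<nq A}))"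
  let ?g = "\<lambda>r i. wt_v A (r !! i) (w !! i) (r !! Suc i)"
  have wt: "wt_v A q a q' \<in> ?V" for q a q'
    by (cases "q < nq A \<and> a < ns A \<and> q' < nq A") (auto simp: wt_v_def image_iff)
  have finV: "finite ?V" by simp
  have sub: "range (?g r) \<subseteq> ?V" for r using wt by auto
  then have fin: "finite (range (?g r))" for r using finV finite_subset by blast
  have eq: "sup_weight A w r = Max (range (?g r))" for r
    unfolding sup_weight_def using fin by (intro cSup_eq_Max) auto
  have "sup_weight A w r \<in> ?V" for r
    using Max_in[OF fin[of r]] sub[of r] unfolding eq by auto
  then show "finite (range (\<lambda>r. sup_weight A w r))"
    using finV by (meson finite_subset image_subsetI)
  show "\<eta> \<le> sup_weight A w r \<longleftrightarrow> (\<exists>i. \<eta> \<le> ?g r i)"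
    unfolding eq using fin by (subst Max_ge_iff) auto
qed

lemma sup_weight_event:
  "{r \<in> space M. sup_weight A w r \<ge> \<eta>} = pwa_word_target.hit_event w (\<lambda>q a q'. \<eta> \<le> wt_v A q a q')"
  "{r \<in> space M. sup_weight A w r \<ge> \<eta>} \<in> sets M"
proof -
  interpret pwa_word_target A w "\<lambda>q a q'. \<eta> \<le> wt_v A q a q'" by unfold_locales
  show "{r \<in> space M. sup_weight A w r \<ge> \<eta>} = hit_event"
    by (simp add: hit_event_def sup_weight_ge_iff)
  then show "{r \<in> space M. sup_weight A w r \<ge> \<eta>} \<in> sets M" using hit_event_sets by simp
qed

text \<open>Its contrapositive supplies the \<open>between\<close> premise: if the event at
  \<open>\<eta>\<close> has larger measure than that at \<open>\<nu>\<close>, some run has a value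
  at least \<open>\<eta>\<close> but below \<open>\<nu>\<close>.\<close>

lemma measure_sup_weight_mono:
  assumes "\<And>r. \<eta> \<le> sup_weight A w r \<Longrightarrow> \<nu> \<le> sup_weight A w r"
  shows "measure M {r \<in> space M. \<eta> \<le> sup_weight A w r} \<le> measure M {r \<in> space M. \<nu> \<le> sup_weight A w r}"
  using assms by (intro M.finite_measure_mono sup_weight_event) auto

lemma L_pos_ge_iff:
  "\<nu> \<le> L_pos A w \<longleftrightarrow> target_automaton.pos_hit (nq A) (init_p A) (trans_p A) (\<lambda>q a q'. \<nu> \<le> wt_v A q a q') w"
proof -
  interpret pwa_word_target A w "\<lambda>q a q'. \<nu> \<le> wt_v A q a q'" by unfold_locales
  have "\<nu> \<le> L_pos A w \<longleftrightarrow> 0 < measure M {r \<in> space M. sup_weight A w r \<ge> \<nu>}"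
    unfolding L_pos_def
  proof (rule Sup_ge_iff_finite_range[OF finite_weights])
    show "0 < measure M {r \<in> space M. \<eta> \<le> sup_weight A w r}" if "\<And>r. \<eta> \<le> sup_weight A w r" for \<eta>
      using that M.prob_space by simp
    show "\<exists>r. \<eta> \<le> sup_weight A w r" if "0 < measure M {r \<in> space M. \<eta> \<le> sup_weight A w r}" for \<eta>
      using that by (rule contrapos_pp) simp
    show "\<exists>r. \<eta> \<le> sup_weight A w r \<and> sup_weight A w r < \<nu>"
      if "0 < measure M {r \<in> space M. \<eta> \<le> sup_weight A w r}"
        "\<not> 0 < measure M {r \<in> space M. \<nu> \<le> sup_weight A w r}" for \<eta>
      using that measure_sup_weight_mono[of \<eta> \<nu>] by (meson not_less less_le_trans)
  qed
  then show ?thesis by (simp only: sup_weight_event(1) measure_hit_event_pos)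
qed

lemma L_as_ge_iff:
  "\<nu> \<le> L_as A w \<longleftrightarrow> target_automaton.as_hit (nq A) (init_p A) (trans_p A) (\<lambda>q a q'. \<nu> \<le> wt_v A q a q') w"
proof -
  interpret pwa_word_target A w "\<lambda>q a q'. \<nu> \<le> wt_v A q a q'" by unfold_locales
  have "\<nu> \<le> L_as A w \<longleftrightarrow> measure M {r \<in> space M. sup_weight A w r \<ge> \<nu>} = 1"
    unfolding L_as_def
  proof (rule Sup_ge_iff_finite_range[OF finite_weights])
    show "measure M {r \<in> space M. \<eta> \<le> sup_weight A w r} = 1" if "\<And>r. \<eta> \<le> sup_weight A w r" for \<eta>
      using that M.prob_space by simp
    show "\<exists>r. \<eta> \<le> sup_weight A w r" if "measure M {r \<in> space M. \<eta> \<le> sup_weight A w r} = 1" for \<eta>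
      using that by (rule contrapos_pp) simp
    show "\<exists>r. \<eta> \<le> sup_weight A w r \<and> sup_weight A w r < \<nu>"
      if "measure M {r \<in> space M. \<eta> \<le> sup_weight A w r} = 1"
        "measure M {r \<in> space M. \<nu> \<le> sup_weight A w r} \<noteq> 1" for \<eta>
      using that measure_sup_weight_mono[of \<eta> \<nu>] M.prob_le_1 by (metis not_less order_antisym)
  qed
  then show ?thesis by (simp only: sup_weight_event(1) measure_hit_event_eq_1)
qed

end

section \<open>The decision procedures\<close>

text \<open>Splits off the first state of a path, in step with the recursion of \<open>hit\<close>
  and \<open>surv\<close> on the word.\<close>

lemma ex_seq_case_nat:
  "(\<exists>s. P s) \<longleftrightarrow> (\<exists>a s. P (case_nat a s))" for P :: "(nat \<Rightarrow> 'a) \<Rightarrow> bool"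
proof
  assume "\<exists>s. P s"
  then obtain s where "P s" ..
  moreover have "s = case_nat (s 0) (\<lambda>i. s (Suc i))" by (auto split: nat.split)
  ultimately show "\<exists>a s. P (case_nat a s)" by metis
qed blast

context target_automaton
begin

text \<open>The quantifiers over states, one for each letter, are merged into one quantifier over a
  state sequence, which a single number can code. Edges after the hit are unconstrained.\<close>

lemma hit_iff_path:
  "q < n \<Longrightarrow> hit q u \<longleftrightarrow> (\<exists>s. (\<forall>i<Suc (length u). s i < n) \<and> s 0 = q \<and>
     (\<exists>j<length u. T (s j) (u ! j) (s (Suc j)) \<and> (\<forall>i<Suc j. 0 < d (s i) (u ! i) (s (Suc i)))))"
proof (induction u arbitrary: q)
  case (Cons a u)
  let ?R = "\<lambda>u q s. (\<forall>i<Suc (length u). s i < n) \<and> s 0 = q \<and>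
     (\<exists>j<length u. T (s j) (u ! j) (s (Suc j)) \<and> (\<forall>i<Suc j. 0 < d (s i) (u ! i) (s (Suc i))))"
  have step: "?R (a # u) q (case_nat b s) \<longleftrightarrow> b = q \<and> 0 < d q a (s 0) \<and> (\<forall>i<Suc (length u). s i < n) \<and>
     (T q a (s 0) \<or> ?R u (s 0) s)" for b s
    using Cons.prems by (auto simp: All_less_Suc2 Ex_less_Suc2)
  have "(\<exists>s. ?R (a # u) q s) \<longleftrightarrow>
      (\<exists>s. 0 < d q a (s 0) \<and> (\<forall>i<Suc (length u). s i < n) \<and> (T q a (s 0) \<or> ?R u (s 0) s))"
    by (subst ex_seq_case_nat, subst step) simp
  also have "\<dots> \<longleftrightarrow> (\<exists>q'<n. 0 < d q a q' \<and> (T q a q' \<or> (\<exists>s. ?R u q' s)))"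
  proof safe
    fix s assume "\<forall>i<Suc (length u). s i < n" "0 < d q a (s 0)" "T q a (s 0)"
    then show "\<exists>q'<n. 0 < d q a q' \<and> (T q a q' \<or> (\<exists>s. ?R u q' s))" by blast
  next
    \<comment> \<open>States are demanded at all positions, also beyond the hit; a constant sequence
      supplies them.\<close>
    fix q' assume "q' < n" "0 < d q a q'" "T q a q'"
    then show "\<exists>s. 0 < d q a (s 0) \<and> (\<forall>i<Suc (length u). s i < n) \<and> (T q a (s 0) \<or> ?R u (s 0) s)"
      by (intro exI[of _ "\<lambda>_. q'"]) auto
  qed blast+
  also have "\<dots> \<longleftrightarrow> hit q (a # u)"
    unfolding hit.simps using Cons.IH
    by (intro ex_cong1 conj_cong disj_cong refl) auto
  finally show ?case ..
qed simp

lemma surv_iff_path: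
  "q < n \<Longrightarrow> surv q u p \<longleftrightarrow> (\<exists>s. (\<forall>i<Suc (length u). s i < n) \<and> s 0 = q \<and> s (length u) = p \<and>
     (\<forall>i<length u. 0 < d (s i) (u ! i) (s (Suc i)) \<and> \<not> T (s i) (u ! i) (s (Suc i))))"
proof (induction u arbitrary: q)
  case Nil
  then show ?case by (auto intro: exI[of _ "\<lambda>_. q"])
next
  case (Cons a u)
  let ?R = "\<lambda>u q s. (\<forall>i<Suc (length u). s i < n) \<and> s 0 = q \<and> s (length u) = p \<and>
     (\<forall>i<length u. 0 < d (s i) (u ! i) (s (Suc i)) \<and> \<not> T (s i) (u ! i) (s (Suc i)))"
  have step: "?R (a # u) q (case_nat b s) \<longleftrightarrow> b = q \<and> 0 < d q a (s 0) \<and> \<not> T q a (s 0) \<and> s 0 < n \<and> ?R u (s 0) s" for b s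
    using Cons.prems by (auto simp: All_less_Suc2)
  have "(\<exists>s. ?R (a # u) q s) \<longleftrightarrow> (\<exists>s. 0 < d q a (s 0) \<and> \<not> T q a (s 0) \<and> s 0 < n \<and> ?R u (s 0) s)"
    by (subst ex_seq_case_nat, subst step) simp
  also have "\<dots> \<longleftrightarrow> (\<exists>q'<n. 0 < d q a q' \<and> \<not> T q a q' \<and> (\<exists>s. ?R u q' s))"
    by blast
  also have "\<dots> \<longleftrightarrow> surv q (a # u) p"
    unfolding surv.simps using Cons.IH by (intro ex_cong1 conj_cong refl) auto
  finally show ?case ..
qed

end

text \<open>The length is a separate argument because 0 is a letter: the number alone does not
  reveal how many letters 0 end the word.\<close>

definition decode_word :: "nat \<Rightarrow> nat \<Rightarrow> nat \<Rightarrow> nat list" where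
  "decode_word k m c = map (digit k c) [0..<m]"

lemma ball_words_iff:
  assumes "0 < k"
  shows "(\<forall>u\<in>lists {..<k}. length u = m \<longrightarrow> P u) \<longleftrightarrow> (\<forall>c<k ^ m. P (decode_word k m c))"
proof (intro iffI ballI allI impI)
  fix u assume u: "u \<in> lists {..<k}" "length u = m" and *: "\<forall>c<k ^ m. P (decode_word k m c)"
  have "u ! i < k" if "i < length u" for i using u(1) that by (auto dest: nth_mem)
  then obtain c where c: "c < k ^ length u" "\<forall>i<length u. digit k c i = u ! i"
    using ex_digits[of "length u" "(!) u" k] by auto
  from c(2) have "decode_word k (length u) c = u"
    by (intro nth_equalityI) (simp_all add: decode_word_def)
  with *[rule_format, of c] c(1) u(2) show "P u" by simp
next
  fix c assume "\<forall>u\<in>lists {..<k}. length u = m \<longrightarrow> P u"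
  moreover have "decode_word k m c \<in> lists {..<k}" "length (decode_word k m c) = m"
    using assms by (auto simp: decode_word_def digit_less)
  ultimately show "P (decode_word k m c)" by blast
qed

lemma ball_short_words_iff:
  assumes "0 < k"
  shows "(\<forall>u\<in>lists {..<k}. length u \<le> b \<longrightarrow> P u) \<longleftrightarrow> (\<forall>m<Suc b. \<forall>c<k ^ m. P (decode_word k m c))"
  unfolding ball_words_iff[OF assms, symmetric] less_Suc_eq_le by blast

lemma bex_short_words_iff:
  assumes "0 < k"
  shows "(\<exists>u\<in>lists {..<k}. length u \<le> b \<and> P u) \<longleftrightarrow> (\<exists>m<Suc b. \<exists>c<k ^ m. P (decode_word k m c))"
  using ball_short_words_iff[OF assms, of b "\<lambda>u. \<not> P u"] by blast

lemma ex_sequence_iff_digits: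
  assumes cong: "\<And>s s'. (\<And>i. i < m \<Longrightarrow> s i = s' i) \<Longrightarrow> P s \<longleftrightarrow> P s'" and "0 < b"
  shows "(\<exists>s. (\<forall>i<m. s i < b) \<and> P s) \<longleftrightarrow> (\<exists>c<b ^ m. P (digit b c))"
proof safe
  fix s assume s: "\<forall>i<m. s i < b" "P s"
  then obtain c where "c < b ^ m" "\<forall>i<m. digit b c i = s i" using ex_digits[of m s b] by auto
  with s(2) show "\<exists>c<b ^ m. P (digit b c)" using cong[of "digit b c" s] by auto
next
  fix c assume "P (digit b c)"
  then show "\<exists>s. (\<forall>i<m. s i < b) \<and> P s" using digit_less[OF \<open>0 < b\<close>] by auto
qed

section \<open>Comparison of coded rationals\<close>

definition rat_pos_code :: "nat \<Rightarrow> bool" where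
  "rat_pos_code c \<longleftrightarrow> 0 < pfst c \<and> pfst c mod 2 = 0"

text \<open>\<open>int_encode\<close> sends z \<ge> 0 to 2z and z < 0 to -2z - 1. Parity thus gives
  the sign, and the two parts recover z as a difference of naturals.\<close>

definition int_pos_part :: "nat \<Rightarrow> nat" where
  "int_pos_part z = (if z mod 2 = 0 then z div 2 else 0)"

definition int_neg_part :: "nat \<Rightarrow> nat" where
  "int_neg_part z = (if z mod 2 = 0 then 0 else Suc (z div 2))"

text \<open>Cross multiplication of the two fractions, with each numerator split into its parts and
  the negative terms moved to the other side to stay within the naturals. Denominators are positive
  and equal their positive part.\<close>

definition rat_le_code :: "nat \<Rightarrow> nat \<Rightarrow> bool" where
  "rat_le_code a b \<longleftrightarrow>
     int_pos_part (pfst a) * int_pos_part (psnd b) + int_neg_part (pfst b) * int_pos_part (psnd a) \<le>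
     int_pos_part (pfst b) * int_pos_part (psnd a) + int_neg_part (pfst a) * int_pos_part (psnd b)"

lemma int_parts: "int (int_pos_part (int_encode z)) - int (int_neg_part (int_encode z)) = z"
  by (cases "0 \<le> z") (auto simp: int_encode_def sum_encode_def int_pos_part_def int_neg_part_def)

lemma int_pos_part_pos: "0 < z \<Longrightarrow> int (int_pos_part (int_encode z)) = z"
  by (auto simp: int_encode_def sum_encode_def int_pos_part_def)

lemma quotient_of_rep:
  obtains a b where "quotient_of r = (a, b)" "0 < b" "r = rat_of_int a / rat_of_int b"
  by (metis quotient_of_denom_pos quotient_of_div surj_pair)

lemma rat_pos_code: "rat_pos_code (enc_rat r) \<longleftrightarrow> 0 < r"
proof -
  obtain a b where ab: "quotient_of r = (a, b)" "0 < b" "r = rat_of_int a / rat_of_int b"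
    by (rule quotient_of_rep)
  have "0 < r \<longleftrightarrow> 0 < a" using ab by (simp add: zero_less_divide_iff)
  also have "\<dots> \<longleftrightarrow> rat_pos_code (enc_rat r)"
    by (cases "0 \<le> a") (auto simp: rat_pos_code_def enc_rat_def ab(1) int_encode_def sum_encode_def)
  finally show ?thesis by simp
qed

lemma rat_le_code: "rat_le_code (enc_rat r) (enc_rat s) \<longleftrightarrow> r \<le> s"
proof -
  obtain a b where ab: "quotient_of r = (a, b)" "0 < b" "r = rat_of_int a / rat_of_int b"
    by (rule quotient_of_rep)
  obtain a' b' where ab': "quotient_of s = (a', b')" "0 < b'" "s = rat_of_int a' / rat_of_int b'"
    by (rule quotient_of_rep)
  define p m where "p = int (int_pos_part (int_encode a))" and "m = int (int_neg_part (int_encode a))"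
  define p' m' where "p' = int (int_pos_part (int_encode a'))" and "m' = int (int_neg_part (int_encode a'))"
  have a: "a = p - m" and a': "a' = p' - m'"
    using int_parts[of a] int_parts[of a'] by (auto simp: p_def m_def p'_def m'_def)
  have "r \<le> s \<longleftrightarrow> rat_of_int (a * b') \<le> rat_of_int (a' * b)"
    unfolding ab(3) ab'(3) of_int_mult using ab(2) ab'(2) by (simp add: field_simps)
  also have "\<dots> \<longleftrightarrow> a * b' \<le> a' * b" by (rule of_int_le_iff)
  also have "\<dots> \<longleftrightarrow> p * b' + m' * b \<le> p' * b + m * b'"
    unfolding a a' by (auto simp: algebra_simps)
  also have "\<dots> \<longleftrightarrow> rat_le_code (enc_rat r) (enc_rat s)"
    unfolding rat_le_code_def enc_rat_def ab(1) ab'(1) p_def m_def p'_def m'_def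
    by (simp add: of_nat_le_iff[where 'a = int, symmetric] int_pos_part_pos ab(2) ab'(2) del: of_nat_le_iff)
  finally show ?thesis by simp
qed

section \<open>The criteria as predicates of the input code\<close>

definition code_n :: "nat \<Rightarrow> nat" where "code_n x = nth_code x 0"
definition code_k :: "nat \<Rightarrow> nat" where "code_k x = nth_code x 1"
definition code_bound :: "nat \<Rightarrow> nat" where "code_bound x = 2 ^ (code_n x * (code_n x + 1))"

definition code_init :: "nat \<Rightarrow> nat \<Rightarrow> bool" where
  "code_init x q \<longleftrightarrow> rat_pos_code (nth_code (nth_code x 2) q)"

definition code_edge :: "nat \<Rightarrow> nat \<Rightarrow> nat \<Rightarrow> nat \<Rightarrow> bool" where
  "code_edge x q a q' \<longleftrightarrow> rat_pos_code (nth_code (nth_code (nth_code (nth_code x 3) q) a) q')"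

definition code_target :: "nat \<Rightarrow> nat \<Rightarrow> nat \<Rightarrow> nat \<Rightarrow> bool" where
  "code_target x q a q' \<longleftrightarrow>
     rat_le_code (nth_code x 5) (nth_code (nth_code (nth_code (nth_code x 4) q) a) q')"

text \<open>\<open>s\<close> codes a path in base \<open>code_n x\<close>; over \<open>m\<close>
  letters it has one state more than letters, hence the exponent \<open>Suc m\<close>.\<close>

definition code_hit :: "nat \<Rightarrow> nat \<Rightarrow> nat \<Rightarrow> nat \<Rightarrow> bool" where
  "code_hit x m c q \<longleftrightarrow> (\<exists>s<code_n x ^ Suc m. digit (code_n x) s 0 = q \<and>
     (\<exists>j<m. code_target x (digit (code_n x) s j) (digit (code_k x) c j) (digit (code_n x) s (Suc j)) \<and>
        (\<forall>i<Suc j. code_edge x (digit (code_n x) s i) (digit (code_k x) c i) (digit (code_n x) s (Suc i)))))"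

definition code_surv :: "nat \<Rightarrow> nat \<Rightarrow> nat \<Rightarrow> nat \<Rightarrow> nat \<Rightarrow> bool" where
  "code_surv x m c q p \<longleftrightarrow> (\<exists>s<code_n x ^ Suc m. digit (code_n x) s 0 = q \<and> digit (code_n x) s m = p \<and>
     (\<forall>i<m. code_edge x (digit (code_n x) s i) (digit (code_k x) c i) (digit (code_n x) s (Suc i)) \<and>
        \<not> code_target x (digit (code_n x) s i) (digit (code_k x) c i) (digit (code_n x) s (Suc i))))"

definition code_alive :: "nat \<Rightarrow> nat \<Rightarrow> nat \<Rightarrow> nat \<Rightarrow> bool" where
  "code_alive x m c p \<longleftrightarrow> (\<exists>q<code_n x. code_init x q \<and> code_surv x m c q p)"

text \<open>Unfolding stops at \<open>nth_code\<close> and \<open>digit\<close>, which have closure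
  rules of their own; bounded quantification over arithmetic remains.\<close>

lemmas code_defs = code_n_def code_k_def code_bound_def code_init_def code_edge_def code_target_def
  code_hit_def code_surv_def code_alive_def rat_pos_code_def rat_le_code_def
  int_pos_part_def int_neg_part_def

lemma decidable_pwaI:
  assumes "recursive_pred D" "\<And>A \<nu>. valid_pwa A \<Longrightarrow> D (enc_input (A, \<nu>)) \<longleftrightarrow> P A \<nu>"
  shows "decidable_pwa P"
  using assms unfolding recursive_pred_def recursive_def decidable_pwa_def by metis

locale pwa_code =
  fixes A :: pwa and \<nu> :: rat
  assumes valid: "valid_pwa A"
begin

abbreviation T :: "nat \<Rightarrow> nat \<Rightarrow> nat \<Rightarrow> bool" where
  "T \<equiv> \<lambda>q a q'. real_of_rat \<nu> \<le> wt_v A q a q'"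

abbreviation x :: nat where
  "x \<equiv> enc_input (A, \<nu>)"

sublocale target_automaton "nq A" "ns A" "init_p A" "trans_p A" T
  by (rule target_automaton_pwa[OF valid])

lemma nth_code_input:
  "nth_code x 0 = nq A" "nth_code x 1 = ns A"
  "nth_code x 2 = enc_list enc_rat (init A)"
  "nth_code x 3 = enc_list (enc_list (enc_list enc_rat)) (trans A)"
  "nth_code x 4 = enc_list (enc_list (enc_list enc_rat)) (wt A)"
  "nth_code x 5 = enc_rat \<nu>"
  unfolding enc_input_def prod.case
  by (simp_all add: nth_code_list_encode del: list_encode.simps)

lemma code_n: "code_n x = nq A"
  by (simp add: code_n_def nth_code_input)

lemma code_k: "code_k x = ns A"
  using nth_code_input(2) by (simp add: code_k_def)

lemma code_bound: "code_bound x = profile_bound"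
  by (simp add: code_bound_def profile_bound_def code_n)

lemma nq_pos: "0 < nq A"
  using valid by (simp add: valid_pwa_def)

lemma code_init: "q < nq A \<Longrightarrow> code_init x q \<longleftrightarrow> q \<in> initial"
  using valid by (simp add: code_init_def nth_code_input nth_code_enc_list rat_pos_code valid_pwa_def
      initial_def init_p_def)

text \<open>The range conditions ensure that \<open>nth_code\<close> reads actual list entries;
  digits in a positive base satisfy them by \<open>digit_less\<close>.\<close>

lemma code_edge:
  "q < nq A \<Longrightarrow> a < ns A \<Longrightarrow> q' < nq A \<Longrightarrow> code_edge x q a q' \<longleftrightarrow> 0 < trans_p A q a q'"
  using valid by (simp add: code_edge_def nth_code_input nth_code_enc_list rat_pos_code valid_pwa_def
      trans_p_def)

lemma code_target:
  "q < nq A \<Longrightarrow> a < ns A \<Longrightarrow> q' < nq A \<Longrightarrow> code_target x q a q' \<longleftrightarrow> T q a q'"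
  using valid by (simp add: code_target_def nth_code_input nth_code_enc_list rat_le_code valid_pwa_def
      wt_v_def of_rat_less_eq)

lemma code_hit: "q < nq A \<Longrightarrow> code_hit x m c q \<longleftrightarrow> hit q (decode_word (ns A) m c)"
proof -
  assume q: "q < nq A"
  let ?u = "decode_word (ns A) m c"
  have len: "length ?u = m" by (simp add: decode_word_def)
  have nth: "?u ! i = digit (ns A) c i" if "i < m" for i using that by (simp add: decode_word_def)
  have "hit q ?u \<longleftrightarrow> (\<exists>s<nq A ^ Suc m. digit (nq A) s 0 = q \<and>
      (\<exists>j<m. T (digit (nq A) s j) (?u ! j) (digit (nq A) s (Suc j)) \<and>
        (\<forall>i<Suc j. 0 < trans_p A (digit (nq A) s i) (?u ! i) (digit (nq A) s (Suc i)))))"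
    unfolding hit_iff_path[OF q] len
    by (rule ex_sequence_iff_digits[OF _ nq_pos]) (auto simp: less_Suc_eq_le)
  also have "\<dots> \<longleftrightarrow> code_hit x m c q"
    unfolding code_hit_def code_n code_k
    by (intro ex_cong1 conj_cong refl all_cong)
       (auto simp: nth code_edge code_target digit_less nq_pos letters)
  finally show ?thesis ..
qed

lemma code_surv: "q < nq A \<Longrightarrow> code_surv x m c q p \<longleftrightarrow> surv q (decode_word (ns A) m c) p"
proof -
  assume q: "q < nq A"
  let ?u = "decode_word (ns A) m c"
  have len: "length ?u = m" by (simp add: decode_word_def)
  have nth: "?u ! i = digit (ns A) c i" if "i < m" for i using that by (simp add: decode_word_def)
  have "surv q ?u p \<longleftrightarrow> (\<exists>s<nq A ^ Suc m. digit (nq A) s 0 = q \<and> digit (nq A) s m = p \<and>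
      (\<forall>i<m. 0 < trans_p A (digit (nq A) s i) (?u ! i) (digit (nq A) s (Suc i)) \<and>
         \<not> T (digit (nq A) s i) (?u ! i) (digit (nq A) s (Suc i))))"
    unfolding surv_iff_path[OF q] len
    by (rule ex_sequence_iff_digits[OF _ nq_pos]) auto
  also have "\<dots> \<longleftrightarrow> code_surv x m c q p"
    unfolding code_surv_def code_n code_k
    by (intro ex_cong1 conj_cong refl all_cong)
       (auto simp: nth code_edge code_target digit_less nq_pos letters)
  finally show ?thesis ..
qed

lemma code_alive: "p < nq A \<Longrightarrow> code_alive x m c p \<longleftrightarrow> p \<in> alive (decode_word (ns A) m c)"
  unfolding code_alive_def alive_def code_n
  using code_init code_surv by (auto simp: initial_def)

lemma bex_word_iff: "(\<exists>w\<in>words A. P w) \<longleftrightarrow> (\<exists>w. sset w \<subseteq> {..<ns A} \<and> P w)"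
  and ball_word_iff: "(\<forall>w\<in>words A. P w) \<longleftrightarrow> (\<forall>w. sset w \<subseteq> {..<ns A} \<longrightarrow> P w)"
  by (auto simp: words_def atLeast0LessThan)

lemma L_ge_iff:
  assumes "w \<in> words A"
  shows "real_of_rat \<nu> \<le> L_pos A w \<longleftrightarrow> pos_hit w" "real_of_rat \<nu> \<le> L_as A w \<longleftrightarrow> as_hit w"
proof -
  interpret pwa_word A w by unfold_locales (fact valid assms)+
  show "real_of_rat \<nu> \<le> L_pos A w \<longleftrightarrow> pos_hit w" by (rule L_pos_ge_iff)
  show "real_of_rat \<nu> \<le> L_as A w \<longleftrightarrow> as_hit w" by (rule L_as_ge_iff)
qed

lemma emptiness_pos_iff:
  "emptiness L_pos A \<nu> \<longleftrightarrow> (\<exists>m<Suc (code_bound x). \<exists>c<code_k x ^ m. \<exists>q<code_n x.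
     code_init x q \<and> code_hit x m c q)"
proof -
  have "emptiness L_pos A \<nu> \<longleftrightarrow> (\<exists>w\<in>words A. pos_hit w)"
    by (simp add: emptiness_def L_ge_iff)
  also have "\<dots> \<longleftrightarrow> (\<exists>m<Suc profile_bound. \<exists>c<ns A ^ m. \<exists>q\<in>initial. hit q (decode_word (ns A) m c))"
    unfolding bex_word_iff ex_pos_hit_iff by (rule bex_short_words_iff[OF letters])
  also have "\<dots> \<longleftrightarrow> (\<exists>m<Suc profile_bound. \<exists>c<ns A ^ m. \<exists>q<nq A. q \<in> initial \<and> hit q (decode_word (ns A) m c))"
    by (auto simp: initial_def)
  finally show ?thesis
    by (simp add: code_bound code_k code_n code_init code_hit cong: conj_cong)
qed

lemma universality_pos_iff:
  "universality L_pos A \<nu> \<longleftrightarrow> (\<forall>c<code_k x ^ code_bound x. \<exists>q<code_n x.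
     code_init x q \<and> code_hit x (code_bound x) c q)"
proof -
  have "universality L_pos A \<nu> \<longleftrightarrow> (\<forall>w\<in>words A. pos_hit w)"
    by (simp add: universality_def L_ge_iff)
  also have "\<dots> \<longleftrightarrow> (\<forall>c<ns A ^ profile_bound. \<exists>q\<in>initial. hit q (decode_word (ns A) profile_bound c))"
    unfolding ball_word_iff all_pos_hit_iff by (rule ball_words_iff[OF letters])
  also have "\<dots> \<longleftrightarrow> (\<forall>c<ns A ^ profile_bound. \<exists>q<nq A. q \<in> initial \<and> hit q (decode_word (ns A) profile_bound c))"
    by (auto simp: initial_def Bex_def)
  finally show ?thesis
    by (simp add: code_bound code_k code_n code_init code_hit cong: conj_cong)
qed

lemma emptiness_as_iff:
  "emptiness L_as A \<nu> \<longleftrightarrow> (\<exists>m<Suc (code_bound x). \<exists>c<code_k x ^ m.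
     \<exists>m'<Suc (code_bound x). \<exists>c'<code_k x ^ m'. \<forall>q<code_n x. code_alive x m c q \<longrightarrow>
       code_hit x m' c' q \<and> (\<forall>p<code_n x. code_surv x m' c' q p \<longrightarrow> code_alive x m c p))"
proof -
  have "emptiness L_as A \<nu> \<longleftrightarrow> (\<exists>w\<in>words A. as_hit w)"
    by (simp add: emptiness_def L_ge_iff)
  also have "\<dots> \<longleftrightarrow> (\<exists>m<Suc profile_bound. \<exists>c<ns A ^ m. \<exists>m'<Suc profile_bound. \<exists>c'<ns A ^ m'.
     \<forall>q\<in>alive (decode_word (ns A) m c). hit q (decode_word (ns A) m' c') \<and>
       (\<forall>p<nq A. surv q (decode_word (ns A) m' c') p \<longrightarrow> p \<in> alive (decode_word (ns A) m c)))"
    unfolding bex_word_iff ex_as_hit_iff bex_short_words_iff[OF letters] ..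
  also have "\<dots> \<longleftrightarrow> (\<exists>m<Suc profile_bound. \<exists>c<ns A ^ m. \<exists>m'<Suc profile_bound. \<exists>c'<ns A ^ m'.
     \<forall>q<nq A. q \<in> alive (decode_word (ns A) m c) \<longrightarrow> hit q (decode_word (ns A) m' c') \<and>
       (\<forall>p<nq A. surv q (decode_word (ns A) m' c') p \<longrightarrow> p \<in> alive (decode_word (ns A) m c)))"
  proof -
    have "(\<forall>q\<in>alive u. P q) \<longleftrightarrow> (\<forall>q<nq A. q \<in> alive u \<longrightarrow> P q)" for u P
      by (auto simp: alive_def)
    then show ?thesis by simp
  qed
  finally show ?thesis
    by (simp add: code_bound code_k code_n code_alive code_hit code_surv)
qed

lemma universality_as_iff:
  "universality L_as A \<nu> \<longleftrightarrow> (\<forall>m<Suc (code_bound x). \<forall>c<code_k x ^ m. \<forall>q<code_n x.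
     code_alive x m c q \<longrightarrow> (\<forall>c'<code_k x ^ code_bound x. code_hit x (code_bound x) c' q))"
proof -
  have "universality L_as A \<nu> \<longleftrightarrow> (\<forall>w\<in>words A. as_hit w)"
    by (simp add: universality_def L_ge_iff)
  also have "\<dots> \<longleftrightarrow> (\<forall>m<Suc profile_bound. \<forall>c<ns A ^ m. \<forall>q\<in>alive (decode_word (ns A) m c).
      \<forall>c'<ns A ^ profile_bound. hit q (decode_word (ns A) profile_bound c'))"
    unfolding ball_word_iff all_as_hit_iff ball_short_words_iff[OF letters] ball_words_iff[OF letters] ..
  also have "\<dots> \<longleftrightarrow> (\<forall>m<Suc profile_bound. \<forall>c<ns A ^ m. \<forall>q<nq A. q \<in> alive (decode_word (ns A) m c) \<longrightarrow>
      (\<forall>c'<ns A ^ profile_bound. hit q (decode_word (ns A) profile_bound c')))"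
  proof -
    have "(\<forall>q\<in>alive u. P q) \<longleftrightarrow> (\<forall>q<nq A. q \<in> alive u \<longrightarrow> P q)" for u P
      by (auto simp: alive_def)
    then show ?thesis by simp
  qed
  finally show ?thesis
    by (simp add: code_bound code_k code_n code_alive code_hit)
qed

end

theorem theorem6:
  shows "decidable_pwa (emptiness L_pos) \<and> decidable_pwa (universality L_pos) \<and>
         decidable_pwa (emptiness L_as) \<and> decidable_pwa (universality L_as)"
proof (intro conjI; rule decidable_pwaI)
  \<comment> \<open>Each recursiveness goal instantiates the schematic predicate of
    \<open>decidable_pwaI\<close>; the closing step then equates it with the semantic
    problem.\<close>
  show "recursive_pred (\<lambda>x. \<exists>m<Suc (code_bound x). \<exists>c<code_k x ^ m. \<exists>q<code_n x.
     code_init x q \<and> code_hit x m c q)"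
    unfolding code_defs by (intro rec_intros)
  show "recursive_pred (\<lambda>x. \<forall>c<code_k x ^ code_bound x. \<exists>q<code_n x.
     code_init x q \<and> code_hit x (code_bound x) c q)"
    unfolding code_defs by (intro rec_intros)
  show "recursive_pred (\<lambda>x. \<exists>m<Suc (code_bound x). \<exists>c<code_k x ^ m.
     \<exists>m'<Suc (code_bound x). \<exists>c'<code_k x ^ m'. \<forall>q<code_n x. code_alive x m c q \<longrightarrow>
       code_hit x m' c' q \<and> (\<forall>p<code_n x. code_surv x m' c' q p \<longrightarrow> code_alive x m c p))"
    unfolding code_defs by (intro rec_intros)
  show "recursive_pred (\<lambda>x. \<forall>m<Suc (code_bound x). \<forall>c<code_k x ^ m. \<forall>q<code_n x.
     code_alive x m c q \<longrightarrow> (\<forall>c'<code_k x ^ code_bound x. code_hit x (code_bound x) c' q))"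
    unfolding code_defs by (intro rec_intros)
qed (simp_all add: pwa_code.intro pwa_code.emptiness_pos_iff pwa_code.universality_pos_iff
    pwa_code.emptiness_as_iff pwa_code.universality_as_iff)

end
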